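(* Let $A$ and $B$ be finite sets, let $\Delta$ be a positive integer, and let $f : A \times B \to \{0, 1, \dots, \Delta\}$ be a function of rank $r$. Then there exists a deterministic communication protocol computing $f$ whose length is at most $\Delta^{O(\Delta)} \cdot \sqrt{r} \cdot \log r$ bits, where the constant in the $O(\cdot)$ is absolute.
   Context: The rank of a function $f : A \times B \to \mathbb{R}$ is the rank of the real matrix $\mathbf{M} \in \mathbb{R}^{A \times B}$ with $\mathbf{M}_{a,b} = f(a,b)$. In the deterministic two-party communication model, Alice receives $a \in A$, Bob receives $b \in B$, and they exchange bits according to a protocol fixed in advance (with unlimited local computation) so that at the end both know $f(a,b)$; the length of a protocol is the maximum number of bits exchanged over all inputs $(a,b)$.
   Formalization: The bound is read with max(2,Δ) in place of the base Δ and log_2 max(2,r) in place of log r, since literally it fails for Δ=1 (2×2 identity matrix) and for r=1 (non-constant rank-one f), and log 0 is undefined for r=0. *)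

theory Defs
  imports "HOL-Analysis.Analysis" "HOL-Library.Function_Algebras" "HOL-Library.FuncSet"
begin

definition fun_scale :: "real \<Rightarrow> ('b \<Rightarrow> real) \<Rightarrow> 'b \<Rightarrow> real"
  where "fun_scale c v = (\<lambda>y. c * v y)"

global_interpretation fun_vs: vector_space "fun_scale :: real \<Rightarrow> ('b \<Rightarrow> real) \<Rightarrow> 'b \<Rightarrow> real"
  by unfold_locales (auto simp: fun_scale_def plus_fun_def algebra_simps)

definition matrix_row :: "'b set \<Rightarrow> ('a \<times> 'b \<Rightarrow> real) \<Rightarrow> 'a \<Rightarrow> 'b \<Rightarrow> real"
  where "matrix_row B M a = (\<lambda>b. if b \<in> B then M (a, b) else 0)"

text \<open>
  The rank of the matrix with entries \<open>M (a, b)\<close>, rows indexed by \<open>A\<close> and columns by \<open>B\<close>.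
  As for the library's \<open>rank\<close>, it is the dimension of the span of the rows; a row is
  extended by zero outside \<open>B\<close>, so that only the entries on \<open>A \<times> B\<close> matter.
  The library's \<open>rank\<close> itself is tied to index types; \<open>rank_on_UNIV\<close> is the agreement.
\<close>
definition rank_on :: "'a set \<Rightarrow> 'b set \<Rightarrow> ('a \<times> 'b \<Rightarrow> real) \<Rightarrow> nat"
  where "rank_on A B M = fun_vs.dim (matrix_row B M ` A)"

lemma rank_on_UNIV:
  fixes M :: "real ^ 'n ^ 'm"
  shows "rank_on UNIV UNIV (\<lambda>(i, j). M $ i $ j) = rank M"
proof -
  have lin: "Vector_Spaces.linear (*s) fun_scale (($) :: real ^ 'n \<Rightarrow> 'n \<Rightarrow> real)"
    by unfold_locales (auto simp: fun_scale_def plus_fun_def)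
  have inj: "inj_on (($) :: real ^ 'n \<Rightarrow> 'n \<Rightarrow> real) S" for S
    by (auto simp: inj_on_def vec_eq_iff)
  interpret V: finite_dimensional_vector_space_pair_1
      "(*s) :: real \<Rightarrow> real ^ 'n \<Rightarrow> real ^ 'n" cart_basis
      "fun_scale :: real \<Rightarrow> ('n \<Rightarrow> real) \<Rightarrow> 'n \<Rightarrow> real" ..
  have "matrix_row UNIV (\<lambda>(i, j). M $ i $ j) ` UNIV = ($) ` rows M"
    by (auto simp: matrix_row_def rows_def row_def)
  then have "rank_on UNIV UNIV (\<lambda>(i, j). M $ i $ j) = vec.dim (rows M)"
    unfolding rank_on_def using V.dim_image_eq[OF lin inj] by simp
  then show ?thesis
    by (simp add: row_rank_def_gen)
qed

text \<open>
  Deterministic two-party protocols as binary trees. At a node \<open>Alice s p0 p1\<close> Alice, holding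
  \<open>a\<close>, sends the bit \<open>s a\<close>, and the protocol continues with \<open>p1\<close> if the bit is true and with
  \<open>p0\<close> otherwise; likewise for Bob. The current node depends only on the bits sent so far, and
  so does the output attached to the leaf that is reached: it is known to both parties.
\<close>
datatype ('a, 'b, 'c) protocol =
    Output 'c
  | Alice "'a \<Rightarrow> bool" "('a, 'b, 'c) protocol" "('a, 'b, 'c) protocol"
  | Bob "'b \<Rightarrow> bool" "('a, 'b, 'c) protocol" "('a, 'b, 'c) protocol"

primrec run :: "('a, 'b, 'c) protocol \<Rightarrow> 'a \<Rightarrow> 'b \<Rightarrow> 'c" where
  "run (Output v) a b = v"
| "run (Alice s p0 p1) a b = (if s a then run p1 a b else run p0 a b)"
| "run (Bob s p0 p1) a b = (if s b then run p1 a b else run p0 a b)"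

primrec bits_exchanged :: "('a, 'b, 'c) protocol \<Rightarrow> 'a \<Rightarrow> 'b \<Rightarrow> nat" where
  "bits_exchanged (Output v) a b = 0"
| "bits_exchanged (Alice s p0 p1) a b =
     Suc (if s a then bits_exchanged p1 a b else bits_exchanged p0 a b)"
| "bits_exchanged (Bob s p0 p1) a b =
     Suc (if s b then bits_exchanged p1 a b else bits_exchanged p0 a b)"

definition computes ::
    "('a, 'b, 'c) protocol \<Rightarrow> 'a set \<Rightarrow> 'b set \<Rightarrow> ('a \<times> 'b \<Rightarrow> 'c) \<Rightarrow> bool"
  where "computes p A B f \<longleftrightarrow> (\<forall>a\<in>A. \<forall>b\<in>B. run p a b = f (a, b))"

text \<open>
  The supremum is a maximum, since \<open>bits_exchanged p\<close> is bounded by the depth of the tree \<open>p\<close>;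
  it is \<open>0\<close> if there are no inputs.
\<close>
definition protocol_length :: "('a, 'b, 'c) protocol \<Rightarrow> 'a set \<Rightarrow> 'b set \<Rightarrow> nat"
  where "protocol_length p A B = (SUP (a, b) \<in> A \<times> B. bits_exchanged p a b)"

end

theory Submission
  imports Defs
begin

text \<open>
  Expanding the rows of \<open>f\<close> in an orthonormal basis of the row space gives
  \<open>f (a, b) = \<Sum>\<^sub>i U a i * V b i\<close> with \<open>|U a|\<^sup>2 \<le> \<Delta>\<^sup>2\<close> and \<open>|V b|\<^sup>2\<close> at most \<open>r\<close> on average, hence at
  most \<open>2 r\<close> for half of the columns. Riesz products over random signs then realise \<open>exp (t f)\<close>,
  up to a constant, as an average of products \<open>\<phi> a * \<psi> b\<close> of nonnegative weights that may be truncated at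
  height \<open>exp (O (t \<Delta> sqrt r))\<close>. A bilinear form on such weights is maximal at indicator functions, so
  entries can be counted in a rectangle of relative size \<open>exp (- O (t \<Delta> sqrt r))\<close> as if each had
  been weighted by \<open>exp (t f)\<close>.

  Some \<open>t = O (\<Delta> log (\<Delta> r))\<close> makes one value of \<open>f\<close> outweigh all others by a factor of order \<open>r\<close>, and a
  rectangle on which a matrix of rank \<open>r\<close> is constant up to a fraction \<open>O (1 / r)\<close> of the entries contains a
  monochromatic rectangle of a quarter of its size. Following Nisan and Wigderson, a monochromatic
  rectangle lets one of the players halve the rank or else shrinks the matrix. The rank drops
  geometrically, so the logarithms of the numbers of leaves sum up to \<open>O (\<Delta>\<^sup>2 sqrt r log (\<Delta> r))\<close>, and
  balancing the protocol tree turns this into a depth.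
\<close>

section \<open>Rank and factorization\<close>

lemma sum_fun_apply: "(\<Sum>x\<in>X. g x) b = (\<Sum>x\<in>X. g x b)"
  for g :: "'i \<Rightarrow> 'b \<Rightarrow> real"
  by (induction X rule: infinite_finite_induct) auto

lemma fun_scale_apply [simp]: "fun_scale c v b = c * v b"
  by (simp add: fun_scale_def)

lemma rank_on_le_card:
  assumes "finite X" and "\<And>a b. a \<in> A \<Longrightarrow> b \<in> B \<Longrightarrow> M (a, b) = (\<Sum>x\<in>X. c a x * g x b)"
  shows "rank_on A B M \<le> card X"
proof -
  define h where "h x b = (if b \<in> B then g x b else 0)" for x b
  have "matrix_row B M a \<in> fun_vs.span (h ` X)" if "a \<in> A" for a
  proof -
    have "matrix_row B M a = (\<Sum>x\<in>X. fun_scale (c a x) (h x))"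
      using assms(2)[OF that] by (auto simp: fun_eq_iff matrix_row_def sum_fun_apply h_def)
    then show ?thesis
      by (simp add: fun_vs.span_sum fun_vs.span_scale fun_vs.span_base)
  qed
  then have "rank_on A B M \<le> card (h ` X)"
    unfolding rank_on_def using assms(1) by (intro fun_vs.dim_le_card) auto
  then show ?thesis
    using card_image_le[OF assms(1), of h] by linarith
qed

lemma row_span_expand:
  assumes "finite X" "inj_on (matrix_row B M) X" "matrix_row B M a \<in> fun_vs.span (matrix_row B M ` X)"
  shows "\<exists>c. \<forall>b\<in>B. M (a, b) = (\<Sum>x\<in>X. c x * M (x, b))"
proof -
  obtain u where u: "matrix_row B M a = (\<Sum>v\<in>matrix_row B M ` X. fun_scale (u v) v)"
    using assms(3) fun_vs.span_finite[of "matrix_row B M ` X"] assms(1) by auto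
  then have "matrix_row B M a = (\<Sum>x\<in>X. fun_scale (u (matrix_row B M x)) (matrix_row B M x))"
    by (simp add: sum.reindex[OF assms(2)])
  then have "\<forall>b\<in>B. M (a, b) = (\<Sum>x\<in>X. u (matrix_row B M x) * M (x, b))"
    by (auto simp: fun_eq_iff sum_fun_apply matrix_row_def split: if_splits)
  then show ?thesis by (intro exI[of _ "\<lambda>x. u (matrix_row B M x)"])
qed

text \<open>The form in which rank is used throughout. The basis consists of rows of the matrix
  itself, so the entries in the rows \<open>X\<close> determine all others.\<close>

lemma rank_on_basis:
  assumes "finite A"
  obtains X c where "X \<subseteq> A" "card X = rank_on A B M"
    "\<And>a b. a \<in> A \<Longrightarrow> b \<in> B \<Longrightarrow> M (a, b) = (\<Sum>x\<in>X. c a x * M (x, b))"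
proof -
  obtain Y where Y: "Y \<subseteq> matrix_row B M ` A" "matrix_row B M ` A \<subseteq> fun_vs.span Y"
      "card Y = rank_on A B M"
    unfolding rank_on_def by (rule fun_vs.basis_exists[of "matrix_row B M ` A"])
  obtain X where X: "X \<subseteq> A" "inj_on (matrix_row B M) X" "Y = matrix_row B M ` X"
    using Y(1) by (auto simp: subset_image_inj)
  have "finite X" using X(1) assms(1) finite_subset by blast
  then have "\<forall>a\<in>A. \<exists>c. \<forall>b\<in>B. M (a, b) = (\<Sum>x\<in>X. c x * M (x, b))"
    using row_span_expand[OF _ X(2)] Y(2) unfolding X(3) by (simp only: image_subset_iff) blast
  then obtain c where "\<forall>a\<in>A. \<forall>b\<in>B. M (a, b) = (\<Sum>x\<in>X. c a x * M (x, b))"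
    unfolding bchoice_iff by blast
  then show ?thesis
    using X(1) Y(3) card_image[OF X(2)] X(3) by (intro that[of X c]) auto
qed

lemma rank_on_mono:
  assumes "finite A" "A' \<subseteq> A" "B' \<subseteq> B"
  shows "rank_on A' B' M \<le> rank_on A B M"
proof -
  obtain X c where X: "X \<subseteq> A" "card X = rank_on A B M"
    "\<And>a b. a \<in> A \<Longrightarrow> b \<in> B \<Longrightarrow> M (a, b) = (\<Sum>x\<in>X. c a x * M (x, b))"
    by (rule rank_on_basis[OF assms(1), where B = B and M = M]) (rule that)
  have "rank_on A' B' M \<le> card X"
  proof (rule rank_on_le_card[where c = c and g = "\<lambda>x b. M (x, b)"])
    show "finite X" using X(1) assms(1) finite_subset by blast
    show "M (a, b) = (\<Sum>x\<in>X. c a x * M (x, b))" if "a \<in> A'" "b \<in> B'" for a b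
      using X(3)[of a b] that assms by blast
  qed
  then show ?thesis using X(2) by simp
qed

text \<open>A factorization through the index set \<open>X\<close> can be read from either side: the
  coefficients \<open>c\<close> become the rows of the transpose.\<close>

lemma rank_on_transpose_le:
  assumes "finite A"
  shows "rank_on B A (\<lambda>(b, a). M (a, b)) \<le> rank_on A B M"
proof -
  obtain X c where X: "X \<subseteq> A" "card X = rank_on A B M"
    "\<And>a b. a \<in> A \<Longrightarrow> b \<in> B \<Longrightarrow> M (a, b) = (\<Sum>x\<in>X. c a x * M (x, b))"
    by (rule rank_on_basis[OF assms(1), where B = B and M = M]) (rule that)
  have "rank_on B A (\<lambda>(b, a). M (a, b)) \<le> card X"
  proof (rule rank_on_le_card[where c = "\<lambda>b x. M (x, b)" and g = "\<lambda>x a. c a x"])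
    show "finite X" using X(1) assms(1) finite_subset by blast
    show "(case (b, a) of (b, a) \<Rightarrow> M (a, b)) = (\<Sum>x\<in>X. M (x, b) * c a x)" if "b \<in> B" "a \<in> A" for a b
      using X(3)[OF that(2,1)] by (simp only: prod.case mult.commute)
  qed
  then show ?thesis using X(2) by simp
qed

text \<open>One additional spanning row suffices, the all-ones row, indexed by
  \<open>None\<close>.\<close>

lemma rank_on_add_const_le:
  assumes "finite A"
  shows "rank_on A B (\<lambda>x. M x + k) \<le> rank_on A B M + 1"
proof -
  obtain X c where X: "X \<subseteq> A" "card X = rank_on A B M"
    "\<And>a b. a \<in> A \<Longrightarrow> b \<in> B \<Longrightarrow> M (a, b) = (\<Sum>x\<in>X. c a x * M (x, b))"
    by (rule rank_on_basis[OF assms(1), where B = B and M = M]) (rule that)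
  have fin: "finite X" using X(1) assms(1) finite_subset by blast
  have "rank_on A B (\<lambda>x. M x + k) \<le> card (insert None (Some ` X))"
  proof (rule rank_on_le_card[where c = "\<lambda>a. case_option k (c a)" and g = "case_option (\<lambda>_. 1) (\<lambda>x b. M (x, b))"])
    show "finite (insert None (Some ` X))" using fin by simp
    fix a b assume "a \<in> A" "b \<in> B"
    have "(\<Sum>y\<in>insert None (Some ` X). case_option k (c a) y * case_option (\<lambda>_. 1) (\<lambda>x b. M (x, b)) y b)
        = k + (\<Sum>x\<in>X. c a x * M (x, b))"
      using fin by (simp add: sum.reindex)
    then show "M (a, b) + k = (\<Sum>y\<in>insert None (Some ` X). case_option k (c a) y * case_option (\<lambda>_. 1) (\<lambda>x b. M (x, b)) y b)"
      using X(3)[OF \<open>a \<in> A\<close> \<open>b \<in> B\<close>] by linarith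
  qed
  also have "\<dots> = rank_on A B M + 1"
    using X(2) fin by (simp add: card_image)
  finally show ?thesis .
qed

text \<open>The rows indexed by \<open>R\<close> vanish after restriction to \<open>S\<close>, so restriction kills their span.\<close>
lemma rank_on_zero_block:
  assumes "finite A" "R \<subseteq> A" "S \<subseteq> B" "\<And>a b. a \<in> R \<Longrightarrow> b \<in> S \<Longrightarrow> M (a, b) = 0"
  shows "rank_on R B M + rank_on A S M \<le> rank_on A B M"
proof -
  let ?row = "matrix_row B M"
  obtain Y1 where Y1: "Y1 \<subseteq> ?row ` R" "fun_vs.independent Y1" "card Y1 = rank_on R B M"
    unfolding rank_on_def by (rule fun_vs.basis_exists[of "?row ` R"])
  have "Y1 \<subseteq> ?row ` A" using Y1 assms(2) by blast
  \<comment> \<open>A basis \<open>Y1\<close> of the rows in \<open>R\<close> is extended to a basis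
    \<open>Y\<close> of all rows. On \<open>S\<close> the members of \<open>Y1\<close> vanish, so
    \<open>Y - Y1\<close> alone spans there.\<close>
  then obtain Y where Y: "Y1 \<subseteq> Y" "Y \<subseteq> ?row ` A" "fun_vs.independent Y" "?row ` A \<subseteq> fun_vs.span Y"
    using Y1(2) by (rule fun_vs.maximal_independent_subset_extend)
  have cY: "card Y = rank_on A B M"
    unfolding rank_on_def using Y(2,4,3) by (rule fun_vs.basis_card_eq_dim)
  have finY: "finite Y" using Y(2) assms(1) finite_subset by blast
  obtain X where X: "X \<subseteq> A" "inj_on ?row X" "Y = ?row ` X"
    using Y(2) by (auto simp: subset_image_inj)
  have fX: "finite X" using X assms(1) finite_subset by blast
  have "\<forall>a\<in>A. \<exists>c. \<forall>b\<in>B. M (a, b) = (\<Sum>x\<in>X. c x * M (x, b))"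
    using row_span_expand[OF fX X(2)] Y(4) unfolding X(3) by (simp only: image_subset_iff) blast
  then obtain c where c: "\<forall>a\<in>A. \<forall>b\<in>B. M (a, b) = (\<Sum>x\<in>X. c a x * M (x, b))"
    unfolding bchoice_iff by blast
  define X' where "X' = {x\<in>X. ?row x \<notin> Y1}"
  \<comment> \<open>An index \<open>x\<close> outside \<open>X'\<close> need not lie in
    \<open>R\<close>; it only shares its row with some element of \<open>R\<close>.\<close>
  have zero: "M (x, b) = 0" if "x \<in> X - X'" "b \<in> S" for x b
  proof -
    from that obtain a where "a \<in> R" "?row x = ?row a" using Y1(1) by (auto simp: X'_def)
    then have "?row x b = ?row a b" by simp
    moreover have "b \<in> B" using that assms(3) by blast
    ultimately have "M (x, b) = M (a, b)" by (simp add: matrix_row_def)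
    then show ?thesis using assms(4)[OF \<open>a \<in> R\<close>] that by simp
  qed
  have "rank_on A S M \<le> card X'"
  proof (rule rank_on_le_card[where c = c and g = "\<lambda>x b. M (x, b)"])
    show "finite X'" using fX by (simp add: X'_def)
    fix a b assume "a \<in> A" "b \<in> S"
    then have "M (a, b) = (\<Sum>x\<in>X. c a x * M (x, b))" using c assms(3) by blast
    also have "\<dots> = (\<Sum>x\<in>X'. c a x * M (x, b))"
      by (rule sum.mono_neutral_right) (use fX zero \<open>b \<in> S\<close> in \<open>auto simp: X'_def\<close>)
    finally show "M (a, b) = \<dots>" .
  qed
  also have "card X' = card (?row ` X')"
    using X(2) by (intro card_image[symmetric]) (auto simp: X'_def inj_on_def)
  also have "?row ` X' = Y - Y1" by (auto simp: X'_def X(3))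
  also have "card (Y - Y1) = rank_on A B M - rank_on R B M"
    using card_Diff_subset[OF finite_subset[OF Y(1) finY] Y(1)] cY Y1(3) by simp
  finally have "rank_on A S M \<le> rank_on A B M - rank_on R B M" .
  moreover have "rank_on R B M \<le> rank_on A B M"
    using card_mono[OF finY Y(1)] cY Y1(3) by simp
  ultimately show ?thesis by linarith
qed

section \<open>Orthonormal factorization with norm bounds\<close>

text \<open>Gram-Schmidt for the inner product summing over \<open>B\<close>. The residual
  \<open>z\<close> of the new vector is normalised and appended, unless it vanishes on
  \<open>B\<close>; hence \<open>k\<close> may be smaller than \<open>card X\<close>.\<close>

lemma orthonormal_expansion:
  fixes g :: "'i \<Rightarrow> 'b \<Rightarrow> real"
  assumes "finite X" "finite B"
  shows "\<exists>k e. k \<le> card X \<and>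
    (\<forall>i<k. \<forall>j<k. (\<Sum>b\<in>B. e i b * e j b) = (if i = j then 1 else 0)) \<and>
    (\<forall>x\<in>X. \<exists>c. \<forall>b\<in>B. g x b = (\<Sum>i<k. c i * e i b))"
  using assms(1)
proof (induction X)
  case empty
  show ?case by (intro exI[of _ 0]) auto
next
  case (insert x X)
  then obtain k and e :: "nat \<Rightarrow> 'b \<Rightarrow> real" where k: "k \<le> card X"
    and e: "\<And>i j. i < k \<Longrightarrow> j < k \<Longrightarrow> (\<Sum>b\<in>B. e i b * e j b) = (if i = j then 1 else 0)"
    and c: "\<And>x. x \<in> X \<Longrightarrow> \<exists>c. \<forall>b\<in>B. g x b = (\<Sum>i<k. c i * e i b)"
    by blast
  define c0 where "c0 i = (\<Sum>b\<in>B. g x b * e i b)" for i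
  define z where "z b = g x b - (\<Sum>i<k. c0 i * e i b)" for b
  define N where "N = (\<Sum>b\<in>B. z b * z b)"
  have orth: "(\<Sum>b\<in>B. z b * e j b) = 0" if "j < k" for j
  proof -
    have "(\<Sum>b\<in>B. (\<Sum>i<k. c0 i * e i b) * e j b) = (\<Sum>i<k. c0 i * (\<Sum>b\<in>B. e i b * e j b))"
      by (simp add: sum_distrib_left sum_distrib_right mult.assoc sum.swap[of _ "{..<k}"])
    also have "\<dots> = (\<Sum>i<k. if i = j then c0 i else 0)"
      by (intro sum.cong) (auto simp: e that)
    also have "\<dots> = c0 j" using that by simp
    finally show ?thesis
      by (simp add: z_def c0_def left_diff_distrib sum_subtractf)
  qed
  show ?case
  proof (cases "N = 0")
    case True
    then have "\<forall>b\<in>B. z b * z b = 0"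
      unfolding N_def using assms(2) by (subst (asm) sum_nonneg_eq_0_iff) auto
    then have "\<forall>b\<in>B. g x b = (\<Sum>i<k. c0 i * e i b)" by (auto simp: z_def)
    then show ?thesis
      using k e c insert.hyps by (intro exI[of _ k] exI[of _ e]) auto
  next
    case False
    have "N \<ge> 0" unfolding N_def by (intro sum_nonneg) auto
    with False have N: "N > 0" by simp
    define e' where "e' = e(k := \<lambda>b. z b / sqrt N)"
    have e'k: "e' k = (\<lambda>b. z b / sqrt N)" and e'e: "\<And>i. i < k \<Longrightarrow> e' i = e i"
      by (auto simp: e'_def)
    have 1: "(\<Sum>b\<in>B. e' i b * e' j b) = (if i = j then 1 else 0)" if ij: "i < Suc k" "j < Suc k" for i j
    proof -
      have kk: "(\<Sum>b\<in>B. e' k b * e' k b) = 1"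
        using N by (simp add: e'k N_def sum_divide_distrib[symmetric])
      have kj: "(\<Sum>b\<in>B. e' k b * e' j b) = 0" if "j < k" for j
        using orth[OF that] by (simp add: e'k e'e[OF that] sum_divide_distrib[symmetric])
      have jk: "(\<Sum>b\<in>B. e' j b * e' k b) = 0" if "j < k" for j
        using kj[OF that] by (simp add: mult.commute)
      show ?thesis
        using ij kk kj jk e e'e by (auto simp: less_Suc_eq)
    qed
    have 2: "\<exists>c. \<forall>b\<in>B. g y b = (\<Sum>i<Suc k. c i * e' i b)" if y: "y \<in> insert x X" for y
    proof (cases "y = x")
      case True
      have "g x b = (\<Sum>i<Suc k. (c0(k := sqrt N)) i * e' i b)" for b
      proof -
        have "(\<Sum>i<Suc k. (c0(k := sqrt N)) i * e' i b) = (\<Sum>i<k. c0 i * e i b) + z b"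
          using N by (simp add: e'k e'e)
        then show ?thesis by (simp add: z_def)
      qed
      then show ?thesis using True by blast
    next
      case False
      then obtain cy where cy: "\<forall>b\<in>B. g y b = (\<Sum>i<k. cy i * e i b)" using c y by auto
      have "(\<Sum>i<Suc k. (cy(k := 0)) i * e' i b) = (\<Sum>i<k. cy i * e i b)" for b
        by (simp add: e'e)
      then show ?thesis using cy by (intro exI[of _ "cy(k := 0)"]) simp
    qed
    show ?thesis
      using 1 2 k insert.hyps by (intro exI[of _ "Suc k"] exI[of _ e']) auto
  qed
qed

text \<open>The coefficient vector of a row has the same norm as the row, at most
  \<open>D * sqrt (card B)\<close>, while the basis has total squared norm \<open>k\<close>. The
  bound is uniform over rows but only an average over columns.\<close>

lemma rank_factorization:
  fixes M :: "'a \<times> 'b \<Rightarrow> real"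
  assumes fin: "finite A" "finite B" and B: "B \<noteq> {}"
    and bound: "\<And>a b. a \<in> A \<Longrightarrow> b \<in> B \<Longrightarrow> \<bar>M (a, b)\<bar> \<le> D"
  obtains U :: "'a \<Rightarrow> nat \<Rightarrow> real" and V :: "'b \<Rightarrow> nat \<Rightarrow> real" and k :: nat where
    "\<And>a b. a \<in> A \<Longrightarrow> b \<in> B \<Longrightarrow> M (a, b) = (\<Sum>i<k. U a i * V b i)"
    "\<And>a. a \<in> A \<Longrightarrow> (\<Sum>i<k. (U a i)\<^sup>2) \<le> D\<^sup>2"
    "(\<Sum>b\<in>B. \<Sum>i<k. (V b i)\<^sup>2) \<le> real (rank_on A B M) * real (card B)"
proof -
  obtain X c where X: "X \<subseteq> A" "card X = rank_on A B M"
    "\<And>a b. a \<in> A \<Longrightarrow> b \<in> B \<Longrightarrow> M (a, b) = (\<Sum>x\<in>X. c a x * M (x, b))"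
    by (rule rank_on_basis[OF fin(1), where B = B and M = M]) (rule that)
  have fX: "finite X" using X(1) fin finite_subset by blast
  obtain k e where k: "k \<le> card X"
    and e: "\<And>i j. i < k \<Longrightarrow> j < k \<Longrightarrow> (\<Sum>b\<in>B. e i b * e j b) = (if i = j then 1 else (0::real))"
    and ex: "\<And>x. x \<in> X \<Longrightarrow> \<exists>c. \<forall>b\<in>B. M (x, b) = (\<Sum>i<k. c i * e i b)"
    using orthonormal_expansion[OF fX fin(2), of "\<lambda>x b. M (x, b)"] by blast
  obtain d where d: "\<And>x b. x \<in> X \<Longrightarrow> b \<in> B \<Longrightarrow> M (x, b) = (\<Sum>i<k. d x i * e i b)"
    using ex by metis
  define u where "u a i = (\<Sum>x\<in>X. c a x * d x i)" for a i
  have Mu: "M (a, b) = (\<Sum>i<k. u a i * e i b)" if "a \<in> A" "b \<in> B" for a b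
  proof -
    have "M (a, b) = (\<Sum>x\<in>X. c a x * (\<Sum>i<k. d x i * e i b))"
      using X(3)[OF that] d that by simp
    also have "\<dots> = (\<Sum>i<k. u a i * e i b)"
      by (simp add: u_def sum_distrib_left sum_distrib_right mult.assoc sum.swap[of _ X])
    finally show ?thesis .
  qed
  define n where "n = real (card B)"
  have n: "n > 0" using fin B by (simp add: n_def card_gt_0_iff)
  have norm_u: "(\<Sum>i<k. (u a i)\<^sup>2) \<le> D\<^sup>2 * n" if a: "a \<in> A" for a
  proof -
    \<comment> \<open>Parseval: the Kronecker delta is written as an inner product of basis vectors,
      and the triple sum is regrouped into squares of entries.\<close>
    have "(\<Sum>i<k. (u a i)\<^sup>2) = (\<Sum>i<k. \<Sum>j<k. u a i * u a j * (\<Sum>b\<in>B. e i b * e j b))"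
    proof (rule sum.cong[OF refl])
      fix i assume i: "i \<in> {..<k}"
      have "(\<Sum>j<k. u a i * u a j * (\<Sum>b\<in>B. e i b * e j b)) = (\<Sum>j<k. if i = j then u a i * u a j else 0)"
        using i e by (intro sum.cong) auto
      then show "(u a i)\<^sup>2 = (\<Sum>j<k. u a i * u a j * (\<Sum>b\<in>B. e i b * e j b))"
        using i by (simp add: power2_eq_square)
    qed
    also have "\<dots> = (\<Sum>i<k. \<Sum>j<k. \<Sum>b\<in>B. (u a i * e i b) * (u a j * e j b))"
      by (simp add: sum_distrib_left mult_ac)
    also have "\<dots> = (\<Sum>i<k. \<Sum>b\<in>B. \<Sum>j<k. (u a i * e i b) * (u a j * e j b))"
      by (intro sum.cong refl sum.swap)
    also have "\<dots> = (\<Sum>b\<in>B. \<Sum>i<k. \<Sum>j<k. (u a i * e i b) * (u a j * e j b))"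
      by (rule sum.swap)
    also have "\<dots> = (\<Sum>b\<in>B. (M (a, b))\<^sup>2)"
      using Mu[OF a] by (simp add: power2_eq_square sum_product)
    also have "\<dots> \<le> (\<Sum>b\<in>B. D\<^sup>2)"
      using bound[OF a] by (intro sum_mono) (metis abs_ge_zero power2_abs power_mono)
    finally show ?thesis by (simp add: n_def mult.commute)
  qed
  \<comment> \<open>Moving a factor \<open>sqrt n\<close> from the row vectors to the column vectors
    makes the row bound independent of the size of \<open>B\<close>.\<close>
  show ?thesis
  proof (rule that[where k = k and U = "\<lambda>a i. u a i / sqrt n" and V = "\<lambda>b i. sqrt n * e i b"])
    show "M (a, b) = (\<Sum>i<k. u a i / sqrt n * (sqrt n * e i b))" if "a \<in> A" "b \<in> B" for a b
      using Mu[OF that] n by simp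
    show "(\<Sum>i<k. (u a i / sqrt n)\<^sup>2) \<le> D\<^sup>2" if "a \<in> A" for a
      using norm_u[OF that] n by (simp add: power_divide sum_divide_distrib[symmetric] divide_le_eq)
    have "(\<Sum>b\<in>B. \<Sum>i<k. (sqrt n * e i b)\<^sup>2) = (\<Sum>i<k. n * (\<Sum>b\<in>B. e i b * e i b))"
      using n by (subst sum.swap)
        (simp add: power_mult_distrib sum_distrib_left[symmetric] power2_eq_square[symmetric])
    also have "\<dots> = real k * n" by (simp add: e)
    also have "\<dots> \<le> real (rank_on A B M) * n" using k X(2) n by (simp add: mult_right_mono)
    finally show "(\<Sum>b\<in>B. \<Sum>i<k. (sqrt n * e i b)\<^sup>2) \<le> real (rank_on A B M) * real (card B)"
      by (simp add: n_def)
  qed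
qed

section \<open>Protocol trees\<close>

text \<open>Leaves are counted before depth: the recursion over rectangles yields very unbalanced
  trees, and leaf counts simply add up along it.\<close>

primrec leaves :: "('a, 'b, 'c) protocol \<Rightarrow> nat" where
  "leaves (Output v) = 1"
| "leaves (Alice s p0 p1) = leaves p0 + leaves p1"
| "leaves (Bob s p0 p1) = leaves p0 + leaves p1"

lemma leaves_pos: "leaves p > 0"
  by (induction p) auto

text \<open>Each player replaces the own input by a representative before speaking; this lifts a
  protocol from distinct rows and columns to all of them.\<close>

lemma protocol_reindex:
  "\<exists>p'. leaves p' = leaves p \<and> (\<forall>a b. run p' a b = run p (h a) (k b))"
proof (induction p)
  case (Output v)
  show ?case by (intro exI[of _ "Output v"]) simp
next
  case (Alice s p0 p1)
  then obtain q0 q1 where "leaves q0 = leaves p0" "\<forall>a b. run q0 a b = run p0 (h a) (k b)"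
    "leaves q1 = leaves p1" "\<forall>a b. run q1 a b = run p1 (h a) (k b)" by blast
  then show ?case by (intro exI[of _ "Alice (s \<circ> h) q0 q1"]) simp
next
  case (Bob s p0 p1)
  then obtain q0 q1 where "leaves q0 = leaves p0" "\<forall>a b. run q0 a b = run p0 (h a) (k b)"
    "leaves q1 = leaves p1" "\<forall>a b. run q1 a b = run p1 (h a) (k b)" by blast
  then show ?case by (intro exI[of _ "Bob (s \<circ> k) q0 q1"]) simp
qed

section \<open>Balancing a protocol tree\<close>

text \<open>Descend into a child with more than \<open>m / 2\<close> leaves until at most
  \<open>m\<close> leaves remain. The inputs reaching the node \<open>q\<close> found there form a
  rectangle, described by \<open>\<alpha>\<close> and \<open>\<beta>\<close>, and \<open>p'\<close>
  is the tree in which the parent of \<open>q\<close> is replaced by the sibling of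
  \<open>q\<close>.\<close>

lemma protocol_split:
  assumes "leaves p > m" "m \<ge> 1"
  shows "\<exists>q p' \<alpha> \<beta>. m < 2 * leaves q \<and> leaves q \<le> m \<and> leaves q + leaves p' = leaves p \<and>
    (\<forall>a b. run p a b = (if \<alpha> a \<and> \<beta> b then run q a b else run p' a b))"
  using assms(1)
proof (induction p)
  case (Output v)
  then show ?case using assms(2) by simp
next
  case (Alice s p0 p1)
  \<comment> \<open>Here \<open>c\<close> is the child entered and \<open>d\<close> its sibling, so
    that one argument serves both children; entering \<open>p0\<close> negates the test.\<close>
  have step: "\<exists>q p' \<alpha> \<beta>. m < 2 * leaves q \<and> leaves q \<le> m \<and> leaves q + leaves p' = leaves c + leaves d \<and>
    (\<forall>a b. (if t a then run c a b else run d a b) = (if \<alpha> a \<and> \<beta> b then run q a b else run p' a b))"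
    if IH: "m < leaves c \<Longrightarrow> \<exists>q p' \<alpha> \<beta>. m < 2 * leaves q \<and> leaves q \<le> m \<and> leaves q + leaves p' = leaves c \<and>
        (\<forall>a b. run c a b = (if \<alpha> a \<and> \<beta> b then run q a b else run p' a b))"
      and big: "m < 2 * leaves c" for c d :: "('a, 'b, 'c) protocol" and t
  proof (cases "leaves c \<le> m")
    case True
    then show ?thesis using big
      by (intro exI[of _ c] exI[of _ d] exI[of _ t] exI[of _ "\<lambda>_. True"]) simp
  next
    case False
    then obtain q p' \<alpha> \<beta> where q: "m < 2 * leaves q" "leaves q \<le> m" "leaves q + leaves p' = leaves c"
      "\<forall>a b. run c a b = (if \<alpha> a \<and> \<beta> b then run q a b else run p' a b)"
      using IH by (auto simp: not_le)
    then show ?thesis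
      by (intro exI[of _ q] exI[of _ "Alice t d p'"] exI[of _ "\<lambda>a. t a \<and> \<alpha> a"] exI[of _ \<beta>]) auto
  qed
  show ?case
  proof (cases "m < 2 * leaves p1")
    case True
    from step[OF Alice.IH(2) this, where t = s and d = p0]
    show ?thesis by (simp only: leaves.simps run.simps add.commute[of "leaves p0"])
  next
    case False
    then have "m < 2 * leaves p0" using Alice.prems by simp
    have neg: "(if \<not> P then x else y) = (if P then y else x)" for P and x y :: 'c by simp
    from step[OF Alice.IH(1) \<open>m < 2 * leaves p0\<close>, where t = "\<lambda>a. \<not> s a" and d = p1]
    show ?thesis by (simp only: neg leaves.simps run.simps)
  qed
next
  case (Bob s p0 p1)
  have step: "\<exists>q p' \<alpha> \<beta>. m < 2 * leaves q \<and> leaves q \<le> m \<and> leaves q + leaves p' = leaves c + leaves d \<and>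
    (\<forall>a b. (if t b then run c a b else run d a b) = (if \<alpha> a \<and> \<beta> b then run q a b else run p' a b))"
    if IH: "m < leaves c \<Longrightarrow> \<exists>q p' \<alpha> \<beta>. m < 2 * leaves q \<and> leaves q \<le> m \<and> leaves q + leaves p' = leaves c \<and>
        (\<forall>a b. run c a b = (if \<alpha> a \<and> \<beta> b then run q a b else run p' a b))"
      and big: "m < 2 * leaves c" for c d :: "('a, 'b, 'c) protocol" and t
  proof (cases "leaves c \<le> m")
    case True
    then show ?thesis using big
      by (intro exI[of _ c] exI[of _ d] exI[of _ "\<lambda>_. True"] exI[of _ t]) simp
  next
    case False
    then obtain q p' \<alpha> \<beta> where q: "m < 2 * leaves q" "leaves q \<le> m" "leaves q + leaves p' = leaves c"
      "\<forall>a b. run c a b = (if \<alpha> a \<and> \<beta> b then run q a b else run p' a b)"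
      using IH by (auto simp: not_le)
    then show ?thesis
      by (intro exI[of _ q] exI[of _ "Bob t d p'"] exI[of _ \<alpha>] exI[of _ "\<lambda>b. t b \<and> \<beta> b"]) auto
  qed
  show ?case
  proof (cases "m < 2 * leaves p1")
    case True
    from step[OF Bob.IH(2) this, where t = s and d = p0]
    show ?thesis by (simp only: leaves.simps run.simps add.commute[of "leaves p0"])
  next
    case False
    then have "m < 2 * leaves p0" using Bob.prems by simp
    have neg: "(if \<not> P then x else y) = (if P then y else x)" for P and x y :: 'c by simp
    from step[OF Bob.IH(1) \<open>m < 2 * leaves p0\<close>, where t = "\<lambda>b. \<not> s b" and d = p1]
    show ?thesis by (simp only: neg leaves.simps run.simps)
  qed
qed

text \<open>
  Some subtree holds between one third and two thirds of the leaves. Two bits decide whether the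
  input reaches it, and the protocol goes on either inside it or in the tree without it.
\<close>
lemma protocol_balance:
  "\<exists>p' d. (\<forall>a b. run p' a b = run p a b \<and> bits_exchanged p' a b \<le> d) \<and> 2 ^ d \<le> leaves p ^ 4"
proof (induction "leaves p" arbitrary: p rule: less_induct)
  case less
  show ?case
  proof (cases "leaves p = 1")
    case True
    then obtain v where "p = Output v"
      by (cases p) (auto simp: add_is_1 leaves_pos[THEN gr_implies_not0])
    then show ?thesis by (intro exI[of _ p] exI[of _ 0]) simp
  next
    case False
    define m where "m = 2 * leaves p div 3"
    have n2: "leaves p \<ge> 2" using False leaves_pos[of p] by linarith
    have m: "m \<ge> 1" "m < leaves p" using n2 by (auto simp: m_def)
    obtain q p' \<alpha> \<beta> where q: "m < 2 * leaves q" "leaves q \<le> m" "leaves q + leaves p' = leaves p"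
      and run: "\<And>a b. run p a b = (if \<alpha> a \<and> \<beta> b then run q a b else run p' a b)"
      using protocol_split[OF m(2,1)] by blast
    have small: "3 * leaves q \<le> 2 * leaves p" "3 * leaves p' \<le> 2 * leaves p"
      using q by (auto simp: m_def)
    \<comment> \<open>The fourth power pays for the two bits of the membership test, because
      \<open>(2/3) ^ 4 = 16/81\<close> is below \<open>1/4\<close>.\<close>
    have IH: "\<exists>t' d. (\<forall>a b. run t' a b = run t a b \<and> bits_exchanged t' a b \<le> d) \<and> 4 * 2 ^ d \<le> leaves p ^ 4"
      if t: "3 * leaves t \<le> 2 * leaves p" for t :: "('a, 'b, 'c) protocol"
    proof -
      have "leaves t < leaves p" using t n2 by linarith
      from less[OF this] obtain t' d where
        t': "\<forall>a b. run t' a b = run t a b \<and> bits_exchanged t' a b \<le> d" "2 ^ d \<le> leaves t ^ 4"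
        by blast
      have "81 * leaves t ^ 4 = (3 * leaves t) ^ 4" by (simp add: power_mult_distrib)
      also have "\<dots> \<le> (2 * leaves p) ^ 4" using t by (rule power_mono) simp
      finally have "4 * leaves t ^ 4 \<le> leaves p ^ 4" by (simp add: power_mult_distrib)
      then have "4 * 2 ^ d \<le> leaves p ^ 4" using t'(2) by linarith
      then show ?thesis using t'(1) by blast
    qed
    obtain q' dq where q': "\<And>a b. run q' a b = run q a b" "\<And>a b. bits_exchanged q' a b \<le> dq"
      "4 * 2 ^ dq \<le> leaves p ^ 4"
      using IH[OF small(1)] by blast
    obtain r' dr where r': "\<And>a b. run r' a b = run p' a b" "\<And>a b. bits_exchanged r' a b \<le> dr"
      "4 * 2 ^ dr \<le> leaves p ^ 4"
      using IH[OF small(2)] by blast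
    have "bits_exchanged q' a b \<le> max dq dr" "bits_exchanged r' a b \<le> max dq dr" for a b
      using q'(2)[of a b] r'(2)[of a b] by auto
    moreover have "2 ^ Suc (Suc (max dq dr)) \<le> leaves p ^ 4"
      using q'(3) r'(3) by (simp add: max_def)
    ultimately show ?thesis
      by (intro exI[of _ "Alice \<alpha> r' (Bob \<beta> r' q')"] exI[of _ "Suc (Suc (max dq dr))"])
        (auto simp: run q' r' le_SucI)
  qed
qed

lemma protocol_length_le:
  assumes "\<And>a b. a \<in> A \<Longrightarrow> b \<in> B \<Longrightarrow> bits_exchanged p a b \<le> d"
  shows "protocol_length p A B \<le> d"
proof (cases "A \<times> B = {}")
  case True
  then show ?thesis by (simp add: protocol_length_def Sup_nat_def)
next
  case False
  then show ?thesis unfolding protocol_length_def using assms by (intro cSUP_least) auto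
qed

text \<open>Inputs are compared with the elements of \<open>A\<close> and \<open>B\<close> one by
  one. The summand \<open>1\<close> is the leaf left when \<open>A\<close> is exhausted.\<close>

lemma protocol_enumerate:
  fixes f :: "'a \<times> 'b \<Rightarrow> 'c"
  assumes "finite A" "finite B"
  shows "\<exists>p :: ('a, 'b, 'c) protocol. computes p A B f \<and> leaves p \<le> 1 + card A * card B"
proof -
  have row: "\<exists>p :: ('a, 'b, 'c) protocol. (\<forall>a. \<forall>b\<in>B. run p a b = g b) \<and> leaves p \<le> max 1 (card B)" for g :: "'b \<Rightarrow> 'c"
    using assms(2)
  proof (induction B)
    case empty
    show ?case by (intro exI[of _ "Output undefined"]) simp
  next
    case (insert x B)
    then obtain p :: "('a, 'b, 'c) protocol" where p: "\<forall>a. \<forall>b\<in>B. run p a b = g b" "leaves p \<le> max 1 (card B)"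
      by blast
    show ?case
    proof (cases "B = {}")
      case True
      then show ?thesis by (intro exI[of _ "Output (g x)"]) simp
    next
      case False
      then have "card B \<ge> 1" using insert by (simp add: Suc_le_eq card_gt_0_iff)
      then show ?thesis using p insert
        by (intro exI[of _ "Bob (\<lambda>b. b = x) p (Output (g x))"]) (auto simp: max_def)
    qed
  qed
  show ?thesis
    using assms(1)
  proof (induction A)
    case empty
    show ?case by (intro exI[of _ "Output undefined"]) (simp add: computes_def)
  next
    case (insert x A)
    then obtain p where p: "computes p A B f" "leaves p \<le> 1 + card A * card B" by blast
    show ?case
    proof (cases "B = {}")
      case True
      then show ?thesis by (intro exI[of _ "Output undefined"]) (simp add: computes_def)
    next
      case False
      then have 1: "max 1 (card B) = card B" using assms(2) by (simp add: max_def Suc_le_eq card_gt_0_iff)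
      obtain q :: "('a, 'b, 'c) protocol" where q: "\<forall>a. \<forall>b\<in>B. run q a b = f (x, b)" "leaves q \<le> card B"
        using row[of "\<lambda>b. f (x, b)"] unfolding 1 by blast
      show ?thesis using p q insert
        by (intro exI[of _ "Alice (\<lambda>a. a = x) p q"]) (auto simp: computes_def)
    qed
  qed
qed

section \<open>Exponentially weighted rectangles\<close>

text \<open>A linear form on a cube \<open>[0, K]\<close> to the power \<open>X\<close> is maximal
  at \<open>K\<close> times the indicator of its positive coefficients. This is applied to
  \<open>\<phi>\<close> for fixed \<open>\<psi>\<close>, and then to \<open>\<psi>\<close> with
  \<open>\<phi>\<close> already replaced by an indicator.\<close>

lemma bilinear_max_at_vertices:
  fixes g :: "'a \<Rightarrow> 'b \<Rightarrow> real"
  assumes "finite A" "finite B"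
    and \<phi>: "\<And>a. a \<in> A \<Longrightarrow> 0 \<le> \<phi> a \<and> \<phi> a \<le> K" and \<psi>: "\<And>b. b \<in> B \<Longrightarrow> 0 \<le> \<psi> b \<and> \<psi> b \<le> K" and "K \<ge> 0"
  obtains R S where "R \<subseteq> A" "S \<subseteq> B"
    "(\<Sum>a\<in>A. \<Sum>b\<in>B. g a b * (\<phi> a * \<psi> b)) \<le> K\<^sup>2 * (\<Sum>a\<in>R. \<Sum>b\<in>S. g a b)"
proof -
  have lin: "(\<Sum>x\<in>X. \<theta> x * h x) \<le> K * (\<Sum>x\<in>{x\<in>X. h x > 0}. h x)"
    if "finite X" "\<And>x. x \<in> X \<Longrightarrow> 0 \<le> \<theta> x \<and> \<theta> x \<le> K" for X :: "'x set" and \<theta> h :: "'x \<Rightarrow> real"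
  proof -
    have "(\<Sum>x\<in>X. \<theta> x * h x) \<le> (\<Sum>x\<in>X. if h x > 0 then K * h x else 0)"
      using that(2) by (intro sum_mono) (auto simp: mult_right_mono mult_nonneg_nonpos)
    also have "\<dots> = K * (\<Sum>x\<in>{x\<in>X. h x > 0}. h x)"
      unfolding sum_distrib_left by (rule sum.inter_filter[OF that(1), symmetric])
    finally show ?thesis .
  qed
  define R where "R = {a\<in>A. (\<Sum>b\<in>B. \<psi> b * g a b) > 0}"
  define S where "S = {b\<in>B. (\<Sum>a\<in>R. g a b) > 0}"
  have "(\<Sum>a\<in>A. \<Sum>b\<in>B. g a b * (\<phi> a * \<psi> b)) = (\<Sum>a\<in>A. \<phi> a * (\<Sum>b\<in>B. \<psi> b * g a b))"
    by (simp add: sum_distrib_left mult_ac)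
  also have "\<dots> \<le> K * (\<Sum>a\<in>R. \<Sum>b\<in>B. \<psi> b * g a b)"
    unfolding R_def using assms(1) \<phi> by (rule lin)
  also have "(\<Sum>a\<in>R. \<Sum>b\<in>B. \<psi> b * g a b) = (\<Sum>b\<in>B. \<psi> b * (\<Sum>a\<in>R. g a b))"
    by (subst sum.swap) (simp add: sum_distrib_left)
  also have "\<dots> \<le> K * (\<Sum>b\<in>S. \<Sum>a\<in>R. g a b)"
    unfolding S_def using assms(2) \<psi> by (rule lin)
  also have "(\<Sum>b\<in>S. \<Sum>a\<in>R. g a b) = (\<Sum>a\<in>R. \<Sum>b\<in>S. g a b)"
    by (rule sum.swap)
  finally have "(\<Sum>a\<in>A. \<Sum>b\<in>B. g a b * (\<phi> a * \<psi> b)) \<le> K\<^sup>2 * (\<Sum>a\<in>R. \<Sum>b\<in>S. g a b)"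
    using \<open>K \<ge> 0\<close> by (simp add: power2_eq_square mult.assoc mult_left_mono)
  then show ?thesis
    by (intro that[of R S]) (auto simp: R_def S_def)
qed

section \<open>Riesz products over random signs\<close>

definition sign_vectors :: "'i set \<Rightarrow> ('i \<Rightarrow> real) set"
  where "sign_vectors I = (\<Pi>\<^sub>E i\<in>I. {-1, 1})"

text \<open>Averaged over independent signs \<open>x\<close>, a product of two of these factorises
  into the product of the \<open>1 + u i * v i\<close>, which is close to the exponential of the
  inner product when the entries are small.\<close>

definition riesz :: "'i set \<Rightarrow> ('i \<Rightarrow> real) \<Rightarrow> ('i \<Rightarrow> real) \<Rightarrow> real"
  where "riesz I u x = (\<Prod>i\<in>I. 1 + x i * u i)"

lemma card_sign_vectors: "finite I \<Longrightarrow> card (sign_vectors I) = 2 ^ card I"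
  by (simp add: sign_vectors_def card_PiE numeral_2_eq_2)

lemma riesz_nonneg:
  assumes "x \<in> sign_vectors I" "\<And>i. i \<in> I \<Longrightarrow> \<bar>u i\<bar> \<le> 1"
  shows "riesz I u x \<ge> 0"
  unfolding riesz_def
proof (rule prod_nonneg)
  fix i assume i: "i \<in> I"
  then have "x i = -1 \<or> x i = 1" using assms(1) by (auto simp: sign_vectors_def PiE_iff)
  then show "0 \<le> 1 + x i * u i" using assms(2)[OF i] by auto
qed

text \<open>Independence of the coordinates, written without the normalisation by
  \<open>2 ^ card I\<close>.\<close>

lemma sum_sign_vectors:
  fixes h :: "'i \<Rightarrow> real \<Rightarrow> real"
  assumes "finite I"
  shows "(\<Sum>x\<in>sign_vectors I. \<Prod>i\<in>I. h i (x i)) = (\<Prod>i\<in>I. h i (-1) + h i 1)"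
  unfolding sign_vectors_def using prod_sum_PiE[of I "\<lambda>_. {-1, 1}" h] assms by simp

lemma sum_riesz2:
  assumes "finite I"
  shows "(\<Sum>x\<in>sign_vectors I. riesz I u x * riesz I v x) = 2 ^ card I * (\<Prod>i\<in>I. 1 + u i * v i)"
proof -
  have "(\<Sum>x\<in>sign_vectors I. riesz I u x * riesz I v x)
      = (\<Prod>i\<in>I. (1 + (-1) * u i) * (1 + (-1) * v i) + (1 + 1 * u i) * (1 + 1 * v i))"
    unfolding riesz_def prod.distrib[symmetric]
    by (rule sum_sign_vectors[OF assms, where h = "\<lambda>i y. (1 + y * u i) * (1 + y * v i)"])
  also have "\<dots> = (\<Prod>i\<in>I. 2 * (1 + u i * v i))"
    by (intro prod.cong) (auto simp: algebra_simps)
  finally show ?thesis by (simp only: prod.distrib prod_constant)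
qed

text \<open>This third mixed moment controls what is lost when the Riesz products are
  truncated.\<close>

lemma sum_riesz3:
  assumes "finite I"
  shows "(\<Sum>x\<in>sign_vectors I. (riesz I u x)\<^sup>2 * riesz I v x) = 2 ^ card I * (\<Prod>i\<in>I. 1 + (u i)\<^sup>2 + 2 * (u i * v i))"
proof -
  have "(\<Sum>x\<in>sign_vectors I. (riesz I u x)\<^sup>2 * riesz I v x)
      = (\<Prod>i\<in>I. (1 + (-1) * u i)\<^sup>2 * (1 + (-1) * v i) + (1 + 1 * u i)\<^sup>2 * (1 + 1 * v i))"
    unfolding riesz_def prod_power_distrib prod.distrib[symmetric]
    by (rule sum_sign_vectors[OF assms, where h = "\<lambda>i y. (1 + y * u i)\<^sup>2 * (1 + y * v i)"])
  also have "\<dots> = (\<Prod>i\<in>I. 2 * (1 + (u i)\<^sup>2 + 2 * (u i * v i)))"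
    by (intro prod.cong) (auto simp: algebra_simps power2_eq_square)
  finally show ?thesis by (simp only: prod.distrib prod_constant)
qed

lemma prod_le_exp_sum:
  fixes y :: "'i \<Rightarrow> real"
  assumes "\<And>i. i \<in> I \<Longrightarrow> 1 + y i \<ge> 0"
  shows "(\<Prod>i\<in>I. 1 + y i) \<le> exp (\<Sum>i\<in>I. y i)"
proof (cases "finite I")
  case True
  have "(\<Prod>i\<in>I. 1 + y i) \<le> (\<Prod>i\<in>I. exp (y i))"
    using assms by (intro prod_mono) auto
  then show ?thesis using True by (simp add: exp_sum)
qed simp

lemma sum_riesz3_le:
  assumes "finite I" "(\<Sum>i\<in>I. (u i)\<^sup>2) \<le> L" "(\<Sum>i\<in>I. u i * v i) \<le> L" "\<And>i. i \<in> I \<Longrightarrow> \<bar>u i\<bar> \<le> 1" "\<And>i. i \<in> I \<Longrightarrow> \<bar>v i\<bar> \<le> 1"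
  shows "(\<Sum>x\<in>sign_vectors I. (riesz I u x)\<^sup>2 * riesz I v x) \<le> 2 ^ card I * exp (3 * L)"
proof -
  have "(\<Prod>i\<in>I. 1 + ((u i)\<^sup>2 + 2 * (u i * v i))) \<le> exp (\<Sum>i\<in>I. (u i)\<^sup>2 + 2 * (u i * v i))"
  proof (rule prod_le_exp_sum)
    fix i assume i: "i \<in> I"
    \<comment> \<open>The factor equals
      \<open>(u i + v i)\<^sup>2 + (1 - (v i)\<^sup>2)\<close>.\<close>
    have "0 \<le> (u i + v i)\<^sup>2" "(v i)\<^sup>2 \<le> 1" using assms(5)[OF i] by (auto simp: abs_square_le_1)
    then show "0 \<le> 1 + ((u i)\<^sup>2 + 2 * (u i * v i))"
      by (simp add: power2_sum)
  qed
  also have "\<dots> \<le> exp (3 * L)"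
    using assms(2,3) by (simp add: sum.distrib sum_distrib_left[symmetric])
  finally show ?thesis
    unfolding sum_riesz3[OF assms(1)] by (simp add: add.assoc)
qed

text \<open>
  The Riesz products are normalised so that the average of \<open>\<phi>\<^sub>a \<psi>\<^sub>b\<close> is about \<open>exp (w a b)\<close>.
  Truncating them at height \<open>8 exp (3 L)\<close> changes this average by at most \<open>1/4\<close>, by a third moment
  bound, and leaves a bilinear form on bounded weights.
\<close>
lemma exp_weighted_rectangle_signs:
  fixes g w :: "'a \<Rightarrow> 'b \<Rightarrow> real" and u :: "'a \<Rightarrow> 'i \<Rightarrow> real"
  assumes fin: "finite A" "finite B" "finite I"
    and u1: "\<And>a i. a \<in> A \<Longrightarrow> i \<in> I \<Longrightarrow> \<bar>u a i\<bar> \<le> 1" and v1: "\<And>b i. b \<in> B \<Longrightarrow> i \<in> I \<Longrightarrow> \<bar>v b i\<bar> \<le> 1"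
    and u2: "\<And>a. a \<in> A \<Longrightarrow> (\<Sum>i\<in>I. (u a i)\<^sup>2) \<le> L" and v2: "\<And>b. b \<in> B \<Longrightarrow> (\<Sum>i\<in>I. (v b i)\<^sup>2) \<le> L"
    and w: "\<And>a b. a \<in> A \<Longrightarrow> b \<in> B \<Longrightarrow> (\<Sum>i\<in>I. u a i * v b i) = w a b"
    and wL: "\<And>a b. a \<in> A \<Longrightarrow> b \<in> B \<Longrightarrow> 0 \<le> w a b \<and> w a b \<le> L"
    and low: "\<And>a b. a \<in> A \<Longrightarrow> b \<in> B \<Longrightarrow> exp (w a b) / 2 \<le> (\<Prod>i\<in>I. 1 + u a i * v b i)"
  obtains R S where "R \<subseteq> A" "S \<subseteq> B"
    "(\<Sum>a\<in>A. \<Sum>b\<in>B. g a b * exp (w a b) * (if g a b \<ge> 0 then 1/4 else 1)) \<le> (8 * exp (3 * L))\<^sup>2 * (\<Sum>a\<in>R. \<Sum>b\<in>S. g a b)"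
proof -
  define K where "K = 8 * exp (3 * L)"
  define N :: real where "N = 2 ^ card I"
  have K: "K > 0" and N: "N > 0" by (auto simp: K_def N_def)
  let ?X = "sign_vectors I"
  \<comment> \<open>Large values are set to zero instead of being lowered to \<open>K\<close>; all
    that matters is that \<open>cut\<close> never increases a value and never exceeds
    \<open>K\<close>.\<close>
  define cut where "cut y = (if y \<le> K then y else 0)" for y
  let ?\<phi> = "\<lambda>a x. riesz I (u a) x" and ?\<psi> = "\<lambda>b x. riesz I (v b) x"
  have \<phi>0: "?\<phi> a x \<ge> 0" if "a \<in> A" "x \<in> ?X" for a x using riesz_nonneg that u1 by blast
  have \<psi>0: "?\<psi> b x \<ge> 0" if "b \<in> B" "x \<in> ?X" for b x using riesz_nonneg that v1 by blast
  define E where "E a b = (\<Sum>x\<in>?X. cut (?\<phi> a x) * cut (?\<psi> b x))" for a b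
  define P where "P a b = (\<Sum>x\<in>?X. ?\<phi> a x * ?\<psi> b x)" for a b
  have Peq: "P a b = N * (\<Prod>i\<in>I. 1 + u a i * v b i)" for a b
    unfolding P_def N_def by (rule sum_riesz2[OF fin(3)])
  have upper: "E a b \<le> N * exp (w a b)" if ab: "a \<in> A" "b \<in> B" for a b
  proof -
    have "E a b \<le> P a b"
      unfolding E_def P_def using \<phi>0 \<psi>0 ab by (intro sum_mono) (auto simp: cut_def)
    also have "(\<Prod>i\<in>I. 1 + u a i * v b i) \<le> exp (\<Sum>i\<in>I. u a i * v b i)"
    proof (rule prod_le_exp_sum)
      fix i assume "i \<in> I"
      then have "\<bar>u a i\<bar> * \<bar>v b i\<bar> \<le> 1 * 1" using u1 v1 ab by (intro mult_mono) auto
      then show "0 \<le> 1 + u a i * v b i" by (simp add: abs_mult[symmetric])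
    qed
    then have "P a b \<le> N * exp (w a b)" using N w ab by (simp add: Peq)
    finally show ?thesis .
  qed
  have lower: "E a b \<ge> N * exp (w a b) / 4" if ab: "a \<in> A" "b \<in> B" for a b
  proof -
    \<comment> \<open>Nothing is lost unless one factor exceeds \<open>K\<close>, and then
      multiplying by that factor over \<open>K\<close> only enlarges \<open>p * q\<close>.\<close>
    have pt: "p * q - cut p * cut q \<le> (p\<^sup>2 * q + q\<^sup>2 * p) / K" if "p \<ge> 0" "q \<ge> 0" for p q
    proof -
      have *: "s * t \<le> s\<^sup>2 * t / K" if "s > K" "t \<ge> 0" for s t
      proof -
        have "K * (s * t) \<le> s * (s * t)" using that K by (intro mult_right_mono) auto
        then show ?thesis using K by (simp add: power2_eq_square mult_ac pos_le_divide_eq)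
      qed
      have nn: "p\<^sup>2 * q / K \<ge> 0" "q\<^sup>2 * p / K \<ge> 0" using that K by auto
      have "p * q \<le> q\<^sup>2 * p / K" if "q > K"
        using *[OF that \<open>p \<ge> 0\<close>] by (simp only: mult.commute[of p q])
      moreover have "p * q \<le> p\<^sup>2 * q / K" if "p > K"
        using *[OF that \<open>q \<ge> 0\<close>] .
      ultimately show ?thesis
        using nn by (cases "p \<le> K"; cases "q \<le> K") (auto simp: cut_def add_divide_distrib not_le)
    qed
    have "P a b - E a b \<le> (\<Sum>x\<in>?X. ((?\<phi> a x)\<^sup>2 * ?\<psi> b x + (?\<psi> b x)\<^sup>2 * ?\<phi> a x) / K)"
      unfolding P_def E_def sum_subtractf[symmetric] using \<phi>0 \<psi>0 ab by (intro sum_mono pt) auto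
    also have "\<dots> = ((\<Sum>x\<in>?X. (?\<phi> a x)\<^sup>2 * ?\<psi> b x) + (\<Sum>x\<in>?X. (?\<psi> b x)\<^sup>2 * ?\<phi> a x)) / K"
      by (simp only: sum.distrib sum_divide_distrib[symmetric])
    also have "\<dots> \<le> (N * exp (3 * L) + N * exp (3 * L)) / K"
    proof -
      have "(\<Sum>x\<in>?X. (?\<phi> a x)\<^sup>2 * ?\<psi> b x) \<le> N * exp (3 * L)"
        unfolding N_def using u1 v1 u2 w wL ab by (intro sum_riesz3_le[OF fin(3)]) auto
      moreover have "(\<Sum>x\<in>?X. (?\<psi> b x)\<^sup>2 * ?\<phi> a x) \<le> N * exp (3 * L)"
        unfolding N_def using u1 v1 v2 w wL ab by (intro sum_riesz3_le[OF fin(3)]) (auto simp: mult.commute)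
      ultimately show ?thesis using K by (simp add: divide_right_mono)
    qed
    \<comment> \<open>The choice \<open>K = 8 * exp (3 * L)\<close> makes the two third moments
      together at most a quarter of \<open>N\<close>; \<open>w a b \<ge> 0\<close> then turns this
      into a quarter of the main term.\<close>
    also have "\<dots> = N / 4" by (simp add: K_def)
    also have "\<dots> \<le> N * exp (w a b) / 4" using N wL[OF ab] by simp
    finally have "P a b - E a b \<le> N * exp (w a b) / 4" .
    moreover have "P a b \<ge> N * exp (w a b) / 2"
      using low[OF ab] N by (simp add: Peq)
    ultimately show ?thesis by simp
  qed
  \<comment> \<open>Positive entries of \<open>g\<close> are charged with the lower bound on
    \<open>E\<close>, negative ones with the upper bound; hence the factors \<open>1/4\<close> and
    \<open>1\<close>.\<close>
  define T where "T = (\<Sum>a\<in>A. \<Sum>b\<in>B. g a b * exp (w a b) * (if g a b \<ge> 0 then 1/4 else 1))"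
  define G where "G x = (\<Sum>a\<in>A. \<Sum>b\<in>B. g a b * (cut (?\<phi> a x) * cut (?\<psi> b x)))" for x
  have "N * T = (\<Sum>a\<in>A. \<Sum>b\<in>B. g a b * (N * exp (w a b) * (if g a b \<ge> 0 then 1/4 else 1)))"
    by (simp add: T_def sum_distrib_left mult_ac)
  also have "\<dots> \<le> (\<Sum>a\<in>A. \<Sum>b\<in>B. g a b * E a b)"
  proof (intro sum_mono)
    fix a b assume ab: "a \<in> A" "b \<in> B"
    show "g a b * (N * exp (w a b) * (if g a b \<ge> 0 then 1/4 else 1)) \<le> g a b * E a b"
    proof (cases "g a b \<ge> 0")
      case True
      then have "g a b * (N * exp (w a b) / 4) \<le> g a b * E a b"
        using lower[OF ab] by (rule mult_left_mono[rotated])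
      then show ?thesis using True by simp
    next
      case False
      then have "g a b * (N * exp (w a b)) \<le> g a b * E a b"
        using upper[OF ab] by (intro mult_left_mono_neg) auto
      then show ?thesis using False by simp
    qed
  qed
  also have "\<dots> = (\<Sum>a\<in>A. \<Sum>b\<in>B. \<Sum>x\<in>?X. g a b * (cut (?\<phi> a x) * cut (?\<psi> b x)))"
    by (simp add: E_def sum_distrib_left)
  also have "\<dots> = (\<Sum>a\<in>A. \<Sum>x\<in>?X. \<Sum>b\<in>B. g a b * (cut (?\<phi> a x) * cut (?\<psi> b x)))"
    by (intro sum.cong refl sum.swap)
  also have "\<dots> = (\<Sum>x\<in>?X. G x)"
    unfolding G_def by (rule sum.swap)
  finally have "N * T \<le> (\<Sum>x\<in>?X. G x)" .
  moreover have "real (card ?X) = N" by (simp add: card_sign_vectors fin N_def)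
  \<comment> \<open>Some sign vector reaches the average over all of them.\<close>
  ultimately have "\<exists>x\<in>?X. G x \<ge> T"
    using sum_bounded_above_strict[of ?X G T] N by (force simp: not_le)
  then obtain x where x: "x \<in> ?X" "G x \<ge> T" by blast
  have "0 \<le> cut (?\<phi> a x) \<and> cut (?\<phi> a x) \<le> K" if "a \<in> A" for a
    using \<phi>0[OF that x(1)] K by (auto simp: cut_def)
  moreover have "0 \<le> cut (?\<psi> b x) \<and> cut (?\<psi> b x) \<le> K" if "b \<in> B" for b
    using \<psi>0[OF that x(1)] K by (auto simp: cut_def)
  ultimately obtain R S where "R \<subseteq> A" "S \<subseteq> B" "G x \<le> K\<^sup>2 * (\<Sum>a\<in>R. \<Sum>b\<in>S. g a b)"
    unfolding G_def using K fin
    by (elim bilinear_max_at_vertices[of A B "\<lambda>a. cut (?\<phi> a x)" K "\<lambda>b. cut (?\<psi> b x)" g, rotated 2]) auto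
  then show ?thesis
    using that[of R S] x(2) by (simp add: T_def K_def)
qed

text \<open>Every coordinate is split into \<open>m\<close> copies scaled by
  \<open>1 / sqrt m\<close>. Norms and inner products stay the same, the entries drop below one, and
  the product becomes \<open>(1 + U a i * V b i / m) ^ m\<close>, which tends to the exponential. As
  \<open>A\<close> and \<open>B\<close> are finite, one \<open>m\<close> serves all pairs.\<close>

lemma exp_weighted_rectangle:
  fixes g w :: "'a \<Rightarrow> 'b \<Rightarrow> real" and U :: "'a \<Rightarrow> nat \<Rightarrow> real" and V :: "'b \<Rightarrow> nat \<Rightarrow> real" and k :: nat
  assumes fin: "finite A" "finite B"
    and u2: "\<And>a. a \<in> A \<Longrightarrow> (\<Sum>i<k. (U a i)\<^sup>2) \<le> L" and v2: "\<And>b. b \<in> B \<Longrightarrow> (\<Sum>i<k. (V b i)\<^sup>2) \<le> L"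
    and w: "\<And>a b. a \<in> A \<Longrightarrow> b \<in> B \<Longrightarrow> (\<Sum>i<k. U a i * V b i) = w a b"
    and wL: "\<And>a b. a \<in> A \<Longrightarrow> b \<in> B \<Longrightarrow> 0 \<le> w a b \<and> w a b \<le> L"
  obtains R S where "R \<subseteq> A" "S \<subseteq> B"
    "(\<Sum>a\<in>A. \<Sum>b\<in>B. g a b * exp (w a b) * (if g a b \<ge> 0 then 1/4 else 1)) \<le> (8 * exp (3 * L))\<^sup>2 * (\<Sum>a\<in>R. \<Sum>b\<in>S. g a b)"
proof -
  have conv: "\<forall>\<^sub>F m in sequentially. exp (w a b) / 2 \<le> (\<Prod>i<k. (1 + U a i * V b i / real m) ^ m)"
    if "a \<in> A" "b \<in> B" for a b
  proof -
    have "(\<lambda>m. \<Prod>i<k. (1 + U a i * V b i / real m) ^ m) \<longlonglongrightarrow> (\<Prod>i<k. exp (U a i * V b i))"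
      by (intro tendsto_prod tendsto_exp_limit_sequentially)
    moreover have "(\<Prod>i<k. exp (U a i * V b i)) = exp (w a b)"
      by (simp add: exp_sum[symmetric] w that)
    ultimately have "\<forall>\<^sub>F m in sequentially. exp (w a b) / 2 < (\<Prod>i<k. (1 + U a i * V b i / real m) ^ m)"
      by (intro order_tendstoD(1)) auto
    then show ?thesis by (rule eventually_mono) simp
  qed
  have "\<forall>\<^sub>F m in sequentially. \<forall>a\<in>A. \<forall>b\<in>B. exp (w a b) / 2 \<le> (\<Prod>i<k. (1 + U a i * V b i / real m) ^ m)"
    using conv fin by (simp add: eventually_ball_finite_distrib)
  moreover have "\<forall>\<^sub>F m in sequentially. real m \<ge> L + 1"
    by (rule eventually_sequentiallyI[of "nat \<lceil>L + 1\<rceil>"]) linarith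
  moreover have "\<forall>\<^sub>F m::nat in sequentially. m > 0"
    by (rule eventually_gt_at_top)
  ultimately have "\<forall>\<^sub>F m in sequentially. (\<forall>a\<in>A. \<forall>b\<in>B. exp (w a b) / 2 \<le> (\<Prod>i<k. (1 + U a i * V b i / real m) ^ m))
      \<and> real m \<ge> L + 1 \<and> m > 0"
    by eventually_elim auto
  then obtain m :: nat where m: "\<And>a b. a \<in> A \<Longrightarrow> b \<in> B \<Longrightarrow> exp (w a b) / 2 \<le> (\<Prod>i<k. (1 + U a i * V b i / real m) ^ m)"
    "real m \<ge> L + 1" "m > 0"
    using eventually_happens'[OF sequentially_bot] by blast
  define I where "I = {..<k} \<times> {..<m}"
  define u where "u a j = U a (fst j) / sqrt (real m)" for a and j :: "nat \<times> nat"
  define v where "v b j = V b (fst j) / sqrt (real m)" for b and j :: "nat \<times> nat"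
  have sumI: "(\<Sum>j\<in>I. F (fst j)) = real m * (\<Sum>i<k. F i)" for F :: "nat \<Rightarrow> real"
    using sum.cartesian_product[of "\<lambda>i l. F i" "{..<m}" "{..<k}"]
    by (simp add: I_def case_prod_beta sum_distrib_left)
  have prodI: "(\<Prod>j\<in>I. F (fst j)) = (\<Prod>i<k. F i ^ m)" for F :: "nat \<Rightarrow> real"
    using prod.cartesian_product[of "\<lambda>i l. F i" "{..<m}" "{..<k}"]
    by (simp add: I_def case_prod_beta)
  have le1: "\<bar>z i / sqrt (real m)\<bar> \<le> 1" if "(\<Sum>i<k. (z i)\<^sup>2) \<le> L" "i < k" for z :: "nat \<Rightarrow> real" and i
  proof -
    have "(z i)\<^sup>2 \<le> (\<Sum>i<k. (z i)\<^sup>2)" using that(2) by (intro member_le_sum) auto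
    then have "(z i)\<^sup>2 \<le> real m" using that(1) m(2) by linarith
    then have "\<bar>z i\<bar> \<le> sqrt (real m)" by (metis real_sqrt_abs real_sqrt_le_mono)
    then show ?thesis using m(3) by simp
  qed
  have uv: "u a j * v b j = U a (fst j) * V b (fst j) / real m" for a b j
    by (simp add: u_def v_def)
  show ?thesis
  proof (rule exp_weighted_rectangle_signs[where A = A and B = B and I = I and u = u and v = v and w = w and L = L and g = g])
    show "\<bar>u a j\<bar> \<le> 1" if "a \<in> A" "j \<in> I" for a j
      unfolding u_def using le1[OF u2[OF that(1)]] that(2) by (auto simp: I_def)
    show "\<bar>v b j\<bar> \<le> 1" if "b \<in> B" "j \<in> I" for b j
      unfolding v_def using le1[OF v2[OF that(1)]] that(2) by (auto simp: I_def)
    show "(\<Sum>j\<in>I. (u a j)\<^sup>2) \<le> L" if "a \<in> A" for a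
      using u2[OF that] m(3) sumI[of "\<lambda>i. (U a i)\<^sup>2 / real m"]
      by (simp add: u_def power_divide sum_divide_distrib[symmetric])
    show "(\<Sum>j\<in>I. (v b j)\<^sup>2) \<le> L" if "b \<in> B" for b
      using v2[OF that] m(3) sumI[of "\<lambda>i. (V b i)\<^sup>2 / real m"]
      by (simp add: v_def power_divide sum_divide_distrib[symmetric])
    show "(\<Sum>j\<in>I. u a j * v b j) = w a b" if "a \<in> A" "b \<in> B" for a b
      using w[OF that] m(3) sumI[of "\<lambda>i. U a i * V b i / real m"]
      by (simp add: uv sum_divide_distrib[symmetric])
    show "exp (w a b) / 2 \<le> (\<Prod>j\<in>I. 1 + u a j * v b j)" if "a \<in> A" "b \<in> B" for a b
      using m(1)[OF that] prodI[of "\<lambda>i. 1 + U a i * V b i / real m"] by (simp add: uv)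
  qed (use fin wL that in \<open>auto simp: I_def\<close>)
qed

section \<open>Monochromatic rectangles\<close>

text \<open>
  The index \<open>j i\<close> maximising \<open>c k exp (2 \<tau> i k)\<close> is nondecreasing in \<open>i\<close> and takes at most
  \<open>D + 1\<close> values, so it is stationary somewhere among \<open>0, \<dots>, D + 1\<close>; midway between two equal
  maximisers the maximum is isolated by a factor of \<open>exp \<tau>\<close>.
\<close>
lemma dominant_exponential_weight:
  fixes c :: "nat \<Rightarrow> real"
  assumes c: "\<And>k. k \<le> D \<Longrightarrow> c k \<ge> 0" and pos: "\<exists>k\<le>D. c k > 0" and \<tau>: "\<tau> > 0"
  obtains t j where "0 \<le> t" "t \<le> 2 * (real D + 1) * \<tau>" "j \<le> D" "c j > 0"
    "\<And>k. k \<le> D \<Longrightarrow> k \<noteq> j \<Longrightarrow> c k * exp (t * real k) \<le> exp (-\<tau>) * (c j * exp (t * real j))"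
proof -
  \<comment> \<open>The grid has spacing \<open>2 * \<tau>\<close>, so that a midpoint is at
    distance \<open>\<tau>\<close> from both neighbours.\<close>
  define s where "s i = 2 * \<tau> * real i" for i :: nat
  have "\<exists>j. j \<le> D \<and> (\<forall>k\<le>D. c k * exp (s i * real k) \<le> c j * exp (s i * real j))" for i
  proof -
    let ?h = "\<lambda>k. c k * exp (s i * real k)"
    have "Max (?h ` {..D}) \<in> ?h ` {..D}" by (intro Max_in) auto
    then obtain j where j: "Max (?h ` {..D}) = ?h j" "j \<in> {..D}" by (rule imageE)
    then show ?thesis by (intro exI[of _ j]) (auto simp flip: j(1) intro!: Max_ge)
  qed
  then have "\<exists>j. \<forall>i. j i \<le> D \<and> (\<forall>k\<le>D. c k * exp (s i * real k) \<le> c (j i) * exp (s i * real (j i)))"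
    by (intro choice) blast
  then obtain j where j: "\<And>i. j i \<le> D"
    and jmax: "\<And>i k. k \<le> D \<Longrightarrow> c k * exp (s i * real k) \<le> c (j i) * exp (s i * real (j i))"
    by blast
  have cj: "c (j i) > 0" for i
  proof -
    obtain k where "k \<le> D" "c k > 0" using pos by blast
    then have "0 < c (j i) * exp (s i * real (j i))"
      using jmax[of k i] by (meson exp_gt_zero less_le_trans mult_pos_pos)
    then show ?thesis by (simp add: zero_less_mult_iff)
  qed
  have mono: "j i \<le> j (Suc i)" for i
  proof (rule ccontr)
    assume "\<not> j i \<le> j (Suc i)"
    define p q where "p = j i" and "q = j (Suc i)"
    have pq: "real q + 1 \<le> real p" using \<open>\<not> j i \<le> j (Suc i)\<close> by (simp add: p_def q_def)
    \<comment> \<open>Exchange argument: the maximality of \<open>p\<close> at \<open>s i\<close>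
      and of \<open>q\<close> at \<open>s (Suc i)\<close> are multiplied, and the coefficients
      cancel.\<close>
    have "(c q * exp (s i * real q)) * (c p * exp (s (Suc i) * real p))
        \<le> (c p * exp (s i * real p)) * (c q * exp (s (Suc i) * real q))"
      unfolding p_def q_def
      by (rule mult_mono[OF jmax[OF j] jmax[OF j]]) (use j c cj in \<open>simp_all add: less_imp_le\<close>)
    then have "(c p * c q) * exp (s i * real q + s (Suc i) * real p)
        \<le> (c p * c q) * exp (s i * real p + s (Suc i) * real q)"
      by (simp add: exp_add mult_ac)
    moreover have "c p * c q > 0" using cj by (simp add: p_def q_def)
    ultimately have "s i * real q + s (Suc i) * real p \<le> s i * real p + s (Suc i) * real q"
      by (simp add: mult_le_cancel_left_pos)
    then have "2 * \<tau> * real p \<le> 2 * \<tau> * real q" by (simp add: s_def algebra_simps)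
    then show False using \<tau> pq by simp
  qed
  \<comment> \<open>Otherwise \<open>j\<close> would increase strictly \<open>D + 1\<close> times
    and exceed \<open>D\<close>.\<close>
  have "\<exists>i\<le>D. j (Suc i) = j i"
  proof (rule ccontr)
    assume *: "\<not> (\<exists>i\<le>D. j (Suc i) = j i)"
    have "i \<le> Suc D \<Longrightarrow> i \<le> j i" for i
    proof (induction i)
      case (Suc i)
      then have "j (Suc i) \<noteq> j i" using * by auto
      then show ?case using Suc mono[of i] by simp
    qed simp
    then have "Suc D \<le> j (Suc D)" by blast
    then show False using j[of "Suc D"] by simp
  qed
  then obtain i where i: "i \<le> D" "j (Suc i) = j i" by blast
  define t where "t = s i + \<tau>"
  have t': "t = s (Suc i) - \<tau>" by (simp add: t_def s_def algebra_simps)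
  show ?thesis
  proof (rule that[of t "j i"])
    show "0 \<le> t" using \<tau> by (simp add: t_def s_def)
    have "\<tau> * (2 * real i + 1) \<le> \<tau> * (2 * (real D + 1))"
      using \<tau> i(1) by (intro mult_left_mono) auto
    then show "t \<le> 2 * (real D + 1) * \<tau>" by (simp add: t_def s_def algebra_simps)
    show "j i \<le> D" by (rule j)
    show "c (j i) > 0" by (rule cj)
    fix k assume k: "k \<le> D" "k \<noteq> j i"
    \<comment> \<open>Transfers maximality from a grid point \<open>z\<close> to \<open>t\<close>.
      Values below \<open>j i\<close> are compared from the left neighbour, values above it from the
      right one; a difference of at least one in value gains \<open>exp \<tau>\<close>.\<close>
    have shift: "c k * exp (t * real k) \<le> exp (-\<tau>) * (c (j i) * exp (t * real (j i)))"
      if le: "c k * exp (z * real k) \<le> c (j i) * exp (z * real (j i))"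
        and d: "(t - z) * real k \<le> - \<tau> + (t - z) * real (j i)" for z
    proof -
      have "c k * exp (t * real k) = (c k * exp (z * real k)) * exp ((t - z) * real k)"
        by (simp add: mult.assoc exp_add[symmetric] algebra_simps)
      also have "\<dots> \<le> (c (j i) * exp (z * real (j i))) * exp (- \<tau> + (t - z) * real (j i))"
        by (rule mult_mono[OF le]) (use d c[OF k(1)] cj[of i] in \<open>simp_all add: less_imp_le\<close>)
      also have "\<dots> = exp (-\<tau>) * (c (j i) * exp (t * real (j i)))"
        by (simp add: mult.assoc mult.left_commute exp_add[symmetric] algebra_simps)
      finally show ?thesis .
    qed
    show "c k * exp (t * real k) \<le> exp (-\<tau>) * (c (j i) * exp (t * real (j i)))"
    proof (cases "k < j i")
      case True
      then have "\<tau> * (real k + 1) \<le> \<tau> * real (j i)" using \<tau> by (intro mult_left_mono) auto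
      then show ?thesis using jmax[OF k(1), of i] by (intro shift[of "s i"]) (auto simp: t_def algebra_simps)
    next
      case False
      then have "\<tau> * (real (j i) + 1) \<le> \<tau> * real k" using \<tau> k(2) by (intro mult_left_mono) auto
      then show ?thesis using jmax[OF k(1), of "Suc i"] i(2)
        by (intro shift[of "s (Suc i)"]) (auto simp: t' algebra_simps)
    qed
  qed
qed

lemma sum_by_value:
  fixes h :: "nat \<Rightarrow> real"
  assumes "finite X" "\<And>x. x \<in> X \<Longrightarrow> f x \<le> D"
  shows "(\<Sum>x\<in>X. h (f x)) = (\<Sum>k\<le>D. real (card {x\<in>X. f x = k}) * h k)"
proof -
  have "(\<Sum>x\<in>X. h (f x)) = (\<Sum>x\<in>X. \<Sum>k\<le>D. if f x = k then h k else 0)"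
    using assms(2) by (intro sum.cong) auto
  also have "\<dots> = (\<Sum>k\<le>D. \<Sum>x\<in>X. if f x = k then h k else 0)"
    by (rule sum.swap)
  also have "\<dots> = (\<Sum>k\<le>D. real (card {x\<in>X. f x = k}) * h k)"
    using assms(1) by (intro sum.cong) (auto simp: sum.inter_filter[symmetric])
  finally show ?thesis .
qed

lemma card_le_by_Markov:
  fixes h :: "'x \<Rightarrow> real"
  assumes "finite X" "\<And>x. x \<in> X \<Longrightarrow> h x \<ge> 0" "m > 0" "(\<Sum>x\<in>X. h x) \<le> m * real (card X)"
  shows "real (card X) \<le> 2 * real (card {x\<in>X. h x \<le> 2 * m})"
proof -
  let ?Y = "{x\<in>X. h x \<le> 2 * m}"
  have "2 * m * real (card (X - ?Y)) = (\<Sum>x\<in>X - ?Y. 2 * m)" by simp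
  also have "\<dots> \<le> (\<Sum>x\<in>X - ?Y. h x)" by (intro sum_mono) auto
  also have "\<dots> \<le> (\<Sum>x\<in>X. h x)" using assms by (intro sum_mono2) auto
  also have "\<dots> \<le> m * real (card X)" by fact
  finally have "2 * real (card (X - ?Y)) \<le> real (card X)" using assms(3) by simp
  moreover have "real (card X) = real (card (X - ?Y)) + real (card ?Y)"
    using assms(1) by (subst card_Diff_subset) (auto simp: of_nat_diff card_mono)
  ultimately show ?thesis by linarith
qed

text \<open>
  Dominates \<open>t D sqrt (2 r)\<close>, the squared norm of the balanced vectors representing \<open>t f\<close>, for the
  exponents \<open>t\<close> of \<open>dominant_exponential_weight\<close> with \<open>exp \<tau> = 8 D \<mu>\<close>.
\<close>
definition boost :: "nat \<Rightarrow> nat \<Rightarrow> real \<Rightarrow> real"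
  where "boost D r \<mu> = 2 * (real D + 1) * ln (8 * real D * \<mu>) * real D * sqrt (2 * real r)"

text \<open>Entries with value \<open>j\<close> count \<open>1\<close> and all others
  \<open>- \<mu>\<close>. The exponential weight makes the sum over the whole matrix positive, and a
  rectangle on which the unweighted sum is positive has the required ratio of good to bad
  entries.\<close>

lemma near_monochromatic_rectangle:
  fixes f :: "'a \<times> 'b \<Rightarrow> nat"
  assumes fin: "finite A" "finite B" and ne: "A \<noteq> {}" "B \<noteq> {}"
    and f: "\<And>a b. a \<in> A \<Longrightarrow> b \<in> B \<Longrightarrow> f (a, b) \<le> D" and D: "D \<ge> 1"
    and r: "rank_on A B (\<lambda>x. real (f x)) \<le> r" "r \<ge> 1" and \<mu>: "\<mu> \<ge> 1"
  obtains R S j where "R \<subseteq> A" "S \<subseteq> B"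
    "\<mu> * real (card {x\<in>R \<times> S. f x \<noteq> j}) \<le> real (card {x\<in>R \<times> S. f x = j})"
    "real (card A * card B) \<le> 1024 * (real D + 1) * exp (6 * boost D r \<mu>) * real (card {x\<in>R \<times> S. f x = j})"
proof -
  have fD: "\<bar>real (f (a, b))\<bar> \<le> real D" if "a \<in> A" "b \<in> B" for a b
    using f[OF that] by simp
  obtain k :: nat and U :: "'a \<Rightarrow> nat \<Rightarrow> real" and V :: "'b \<Rightarrow> nat \<Rightarrow> real" where
    UV: "\<And>a b. a \<in> A \<Longrightarrow> b \<in> B \<Longrightarrow> real (f (a, b)) = (\<Sum>i<k. U a i * V b i)"
    and U: "\<And>a. a \<in> A \<Longrightarrow> (\<Sum>i<k. (U a i)\<^sup>2) \<le> (real D)\<^sup>2"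
    and V: "(\<Sum>b\<in>B. \<Sum>i<k. (V b i)\<^sup>2) \<le> real (rank_on A B (\<lambda>x. real (f x))) * real (card B)"
  proof (rule rank_factorization[OF fin ne(2), where M = "\<lambda>x. real (f x)" and D = "real D"])
    show "\<bar>real (f (a, b))\<bar> \<le> real D" if "a \<in> A" "b \<in> B" for a b
      using that by (rule fD)
  qed (rule that)
  \<comment> \<open>Keeping the columns of at most twice the average squared norm costs at most half
    of the columns.\<close>
  define B' where "B' = {b\<in>B. (\<Sum>i<k. (V b i)\<^sup>2) \<le> 2 * real r}"
  have V': "(\<Sum>b\<in>B. \<Sum>i<k. (V b i)\<^sup>2) \<le> real r * real (card B)"
    using V r(1) by (meson mult_right_mono of_nat_0_le_iff of_nat_mono order_trans)
  have B'B: "B' \<subseteq> B" by (auto simp: B'_def)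
  have finB': "finite B'" using B'B fin finite_subset by blast
  have cardB': "real (card B) \<le> 2 * real (card B')"
    unfolding B'_def by (rule card_le_by_Markov) (use fin r V' in \<open>auto intro: sum_nonneg\<close>)
  define n where "n = real (card A) * real (card B)"
  have n: "n > 0" using fin ne by (simp add: n_def card_gt_0_iff)
  let ?X = "A \<times> B'"
  have finX: "finite ?X" using fin finB' by simp
  have fX: "f x \<le> D" if "x \<in> ?X" for x using that f B'B by (cases x) auto
  define c where "c v = real (card {x\<in>?X. f x = v})" for v
  have "n \<le> real (card A) * (2 * real (card B'))"
    unfolding n_def using cardB' by (intro mult_left_mono) auto
  also have "\<dots> = 2 * (\<Sum>x\<in>?X. 1)" by (simp add: card_cartesian_product)
  also have "(\<Sum>x\<in>?X. 1) = (\<Sum>v\<le>D. c v * 1)"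
    unfolding c_def using sum_by_value[OF finX fX, where h = "\<lambda>_. 1"] by simp
  finally have csum: "n \<le> 2 * (\<Sum>v\<le>D. c v)" by simp
  have cpos: "\<exists>v\<le>D. c v > 0"
  proof (rule ccontr)
    assume "\<not> ?thesis"
    then have "(\<Sum>v\<le>D. c v) \<le> 0" by (intro sum_nonpos) (auto simp: not_less)
    then show False using csum n by linarith
  qed
  \<comment> \<open>At most \<open>D\<close> other values, each of weight at most
    \<open>exp (- \<tau>)\<close> times that of \<open>j\<close> and penalised by
    \<open>\<mu>\<close>, then cost an eighth of the weight of \<open>j\<close>, against the gain of
    a quarter.\<close>
  define \<tau> where "\<tau> = ln (8 * real D * \<mu>)"
  have D\<mu>: "real D * \<mu> \<ge> 1" using D \<mu> mult_mono[of 1 "real D" 1 \<mu>] by simp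
  have "8 * real D * \<mu> > 1" using D\<mu> by (simp only: mult.assoc)
  then have \<tau>: "\<tau> > 0" unfolding \<tau>_def by (rule ln_gt_zero)
  have "exp \<tau> = 8 * real D * \<mu>"
    unfolding \<tau>_def using \<open>8 * real D * \<mu> > 1\<close> by (intro exp_ln) linarith
  then have exp\<tau>: "exp (-\<tau>) * (8 * real D * \<mu>) = 1"
    by (metis exp_minus_inverse mult.commute)
  obtain t j where t: "0 \<le> t" "t \<le> 2 * (real D + 1) * \<tau>" and j: "j \<le> D" "c j > 0"
    and dom: "\<And>v. v \<le> D \<Longrightarrow> v \<noteq> j \<Longrightarrow> c v * exp (t * real v) \<le> exp (-\<tau>) * (c j * exp (t * real j))"
    using dominant_exponential_weight[of D c \<tau>] cpos \<tau> by (auto simp: c_def)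
  define L where "L = t * real D * sqrt (2 * real r)"
  have sq1: "sqrt (2 * real r) \<ge> 1" using r(2) by simp
  have L: "L \<le> boost D r \<mu>"
    unfolding L_def boost_def \<tau>_def[symmetric] using t by (intro mult_right_mono) auto
  \<comment> \<open>The scalings have product \<open>t\<close> and make the bounds for both sides
    equal: \<open>\<alpha>\<^sup>2 * D\<^sup>2\<close> and \<open>\<beta>\<^sup>2 * (2 * r)\<close>
    are both \<open>L\<close>.\<close>
  define \<alpha> where "\<alpha> = sqrt (t * sqrt (2 * real r) / real D)"
  define \<beta> where "\<beta> = sqrt (t * real D / sqrt (2 * real r))"
  have \<alpha>\<beta>: "\<alpha> * \<beta> = t"
    unfolding \<alpha>_def \<beta>_def real_sqrt_mult[symmetric] using D r(2) t by simp
  have \<alpha>2: "\<alpha>\<^sup>2 = t * sqrt (2 * real r) / real D" and \<beta>2: "\<beta>\<^sup>2 = t * real D / sqrt (2 * real r)"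
    using t by (auto simp: \<alpha>_def \<beta>_def)
  define g where "g a b = (if f (a, b) = j then 1 else - \<mu>)" for a b
  have "\<exists>R S. R \<subseteq> A \<and> S \<subseteq> B' \<and> (\<Sum>a\<in>A. \<Sum>b\<in>B'. g a b * exp (t * real (f (a, b))) * (if g a b \<ge> 0 then 1/4 else 1))
      \<le> (8 * exp (3 * L))\<^sup>2 * (\<Sum>a\<in>R. \<Sum>b\<in>S. g a b)"
  proof (rule exp_weighted_rectangle[where A = A and B = B' and U = "\<lambda>a i. \<alpha> * U a i" and V = "\<lambda>b i. \<beta> * V b i"
        and w = "\<lambda>a b. t * real (f (a, b))" and L = L and k = k and g = g])
    show "(\<Sum>i<k. (\<alpha> * U a i)\<^sup>2) \<le> L" if "a \<in> A" for a
    proof -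
      have "(\<Sum>i<k. (\<alpha> * U a i)\<^sup>2) = \<alpha>\<^sup>2 * (\<Sum>i<k. (U a i)\<^sup>2)"
        by (simp add: power_mult_distrib sum_distrib_left)
      also have "\<dots> \<le> \<alpha>\<^sup>2 * (real D)\<^sup>2" using U[OF that] by (intro mult_left_mono) auto
      also have "\<dots> = L" unfolding \<alpha>2 using D by (simp add: L_def power2_eq_square)
      finally show ?thesis .
    qed
    show "(\<Sum>i<k. (\<beta> * V b i)\<^sup>2) \<le> L" if "b \<in> B'" for b
    proof -
      have "(\<Sum>i<k. (\<beta> * V b i)\<^sup>2) = \<beta>\<^sup>2 * (\<Sum>i<k. (V b i)\<^sup>2)"
        by (simp add: power_mult_distrib sum_distrib_left)
      also have "\<dots> \<le> \<beta>\<^sup>2 * (2 * real r)" using that by (intro mult_left_mono) (auto simp: B'_def)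
      also have "\<dots> = t * real D * ((2 * real r) / sqrt (2 * real r))" by (simp add: \<beta>2)
      also have "(2 * real r) / sqrt (2 * real r) = sqrt (2 * real r)"
        by (rule real_div_sqrt) simp
      finally show ?thesis by (simp add: L_def)
    qed
    show "(\<Sum>i<k. \<alpha> * U a i * (\<beta> * V b i)) = t * real (f (a, b))" if "a \<in> A" "b \<in> B'" for a b
    proof -
      have "(\<Sum>i<k. \<alpha> * U a i * (\<beta> * V b i)) = \<alpha> * \<beta> * (\<Sum>i<k. U a i * V b i)"
        by (simp add: sum_distrib_left mult_ac)
      then show ?thesis using UV[of a b] that B'B \<alpha>\<beta> by auto
    qed
    show "0 \<le> t * real (f (a, b)) \<and> t * real (f (a, b)) \<le> L" if "a \<in> A" "b \<in> B'" for a b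
    proof -
      have "t * real (f (a, b)) \<le> t * real D * 1" using fX[of "(a, b)"] that t by (simp add: mult_left_mono)
      also have "\<dots> \<le> L" unfolding L_def using sq1 t by (intro mult_left_mono) auto
      finally show ?thesis using t by simp
    qed
  qed (use fin finB' in auto)
  then obtain R S where RS: "R \<subseteq> A" "S \<subseteq> B'"
    and le: "(\<Sum>a\<in>A. \<Sum>b\<in>B'. g a b * exp (t * real (f (a, b))) * (if g a b \<ge> 0 then 1/4 else 1))
      \<le> (8 * exp (3 * L))\<^sup>2 * (\<Sum>a\<in>R. \<Sum>b\<in>S. g a b)"
    by blast
  \<comment> \<open>Since \<open>t \<ge> 0\<close>, this dominant weight bounds every plain count
    \<open>c v\<close>, so it is at least a fraction of order \<open>1 / (D + 1)\<close> of the
    number of entries.\<close>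
  define W where "W = c j * exp (t * real j)"
  have Wge: "c v \<le> W" if "v \<le> D" for v
  proof -
    have "c v * 1 \<le> c v * exp (t * real v)" using t by (intro mult_left_mono) (auto simp: c_def)
    also have "\<dots> \<le> W"
    proof (cases "v = j")
      case False
      then have "c v * exp (t * real v) \<le> exp (-\<tau>) * W" using dom that by (simp add: W_def)
      also have "\<dots> \<le> 1 * W" using \<tau> j by (intro mult_right_mono) (auto simp: W_def)
      finally show ?thesis by simp
    qed (simp add: W_def)
    finally show ?thesis by simp
  qed
  have "(\<Sum>v\<le>D. c v) \<le> (\<Sum>v\<le>D. W)" using Wge by (intro sum_mono) auto
  then have nW: "n \<le> 2 * (real D + 1) * W" using csum by (simp add: algebra_simps)
  define G where "G v = (if v = j then 1 / 4 else - \<mu>) * exp (t * real v)" for v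
  have "(\<Sum>a\<in>A. \<Sum>b\<in>B'. g a b * exp (t * real (f (a, b))) * (if g a b \<ge> 0 then 1/4 else 1))
      = (\<Sum>a\<in>A. \<Sum>b\<in>B'. G (f (a, b)))"
    using \<mu> by (intro sum.cong) (auto simp: G_def g_def)
  also have "\<dots> = (\<Sum>x\<in>?X. G (f x))"
    by (simp add: sum.cartesian_product case_prod_beta)
  also have "\<dots> = (\<Sum>v\<le>D. c v * G v)"
    unfolding c_def by (rule sum_by_value[OF finX fX])
  also have "\<dots> = W / 4 + (\<Sum>v\<in>{..D} - {j}. c v * G v)"
    using j by (subst sum.remove[of _ j]) (auto simp: G_def W_def)
  also have "\<dots> \<ge> W / 4 + (\<Sum>v\<in>{..D} - {j}. - (\<mu> * (exp (-\<tau>) * W)))"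
  proof (intro add_left_mono sum_mono)
    fix v assume "v \<in> {..D} - {j}"
    then have "c v * exp (t * real v) \<le> exp (-\<tau>) * W" "v \<noteq> j" using dom by (auto simp: W_def)
    then show "- (\<mu> * (exp (-\<tau>) * W)) \<le> c v * G v"
      using \<mu> by (simp add: G_def mult.left_commute)
  qed
  also have "(\<Sum>v\<in>{..D} - {j}. - (\<mu> * (exp (-\<tau>) * W))) = - (W * (exp (-\<tau>) * (real D * \<mu>)))"
    using j by (simp add: card_Diff_singleton)
  also have "exp (-\<tau>) * (real D * \<mu>) = 1 / 8" using exp\<tau> by simp
  finally have "W / 8 \<le> (8 * exp (3 * L))\<^sup>2 * (\<Sum>a\<in>R. \<Sum>b\<in>S. g a b)" using le by simp
  also have "(8 * exp (3 * L))\<^sup>2 = 64 * exp (6 * L)"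
    by (simp add: power_mult_distrib exp_double[symmetric])
  finally have main: "W / 8 \<le> 64 * exp (6 * L) * (\<Sum>a\<in>R. \<Sum>b\<in>S. g a b)" .
  define good where "good = real (card {x\<in>R \<times> S. f x = j})"
  define bad where "bad = real (card {x\<in>R \<times> S. f x \<noteq> j})"
  have finRS: "finite (R \<times> S)" using RS fin finB' by (meson finite_SigmaI finite_subset)
  have "(\<Sum>a\<in>R. \<Sum>b\<in>S. g a b) = (\<Sum>x\<in>R \<times> S. (if f x = j then 1 else 0) - \<mu> * (if f x \<noteq> j then 1 else 0))"
    by (subst sum.cartesian_product) (auto intro!: sum.cong simp: g_def)
  also have "\<dots> = good - \<mu> * bad"
    unfolding good_def bad_def sum_subtractf sum_distrib_left[symmetric]
    using finRS by (simp add: sum.inter_filter[symmetric])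
  finally have gb: "(\<Sum>a\<in>R. \<Sum>b\<in>S. g a b) = good - \<mu> * bad" .
  have "W > 0" using j by (simp add: W_def)
  then have "0 < 64 * exp (6 * L) * (good - \<mu> * bad)" using main unfolding gb by linarith
  then have pos: "good - \<mu> * bad > 0" by (simp add: zero_less_mult_iff)
  have "n \<le> 2 * (real D + 1) * (8 * (64 * exp (6 * L) * (good - \<mu> * bad)))"
    using nW main unfolding gb by (elim order_trans) (intro mult_left_mono, auto)
  also have "\<dots> = 1024 * (real D + 1) * exp (6 * L) * (good - \<mu> * bad)"
    by (simp add: algebra_simps)
  also have "\<dots> \<le> 1024 * (real D + 1) * exp (6 * boost D r \<mu>) * good"
    using L pos \<mu> by (intro mult_mono) (auto simp: bad_def)
  finally have "real (card A * card B) \<le> 1024 * (real D + 1) * exp (6 * boost D r \<mu>) * good"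
    by (simp add: n_def)
  then show ?thesis
    using that[of R S j] RS B'B pos by (auto simp: good_def bad_def)
qed

text \<open>Rows with at most twice the average number of errors make up half of \<open>R\<close>.
  There \<open>f - j\<close> has rank at most \<open>r + 1\<close>, so its rows are combinations of
  at most \<open>r + 1\<close> of them. Deleting the columns in which one of these basis rows errs
  leaves half of \<open>S\<close>, and on the rest every combination vanishes.\<close>

lemma monochromatic_rectangle:
  fixes f :: "'a \<times> 'b \<Rightarrow> nat"
  assumes fin: "finite A" "finite B" and ne: "A \<noteq> {}" "B \<noteq> {}"
    and f: "\<And>a b. a \<in> A \<Longrightarrow> b \<in> B \<Longrightarrow> f (a, b) \<le> D" and D: "D \<ge> 1"
    and r: "rank_on A B (\<lambda>x. real (f x)) \<le> r" "r \<ge> 1"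
  obtains R S j where "R \<subseteq> A" "S \<subseteq> B" "\<And>a b. a \<in> R \<Longrightarrow> b \<in> S \<Longrightarrow> f (a, b) = j"
    "real (card A * card B) \<le> 4096 * (real D + 1) * exp (6 * boost D r (4 * (real r + 1))) * real (card R * card S)"
proof -
  \<comment> \<open>With this value the \<open>r + 1\<close> basis rows, each with at most
    \<open>2 * card S / \<mu>\<close> errors, spoil at most half of the columns.\<close>
  define \<mu> where "\<mu> = 4 * (real r + 1)"
  obtain R S j where RS: "R \<subseteq> A" "S \<subseteq> B"
    and bad: "\<mu> * real (card {x\<in>R \<times> S. f x \<noteq> j}) \<le> real (card {x\<in>R \<times> S. f x = j})"
    and good: "real (card A * card B) \<le> 1024 * (real D + 1) * exp (6 * boost D r \<mu>) * real (card {x\<in>R \<times> S. f x = j})"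
    using near_monochromatic_rectangle[OF fin ne f D r, of \<mu>] by (auto simp: \<mu>_def)
  have finRS: "finite R" "finite S" using RS fin finite_subset by blast+
  have "real (card A * card B) > 0" using fin ne by (simp add: card_gt_0_iff)
  have le_size: "card {x\<in>R \<times> S. f x = j} \<le> card R * card S"
    using card_mono[of "R \<times> S" "{x\<in>R \<times> S. f x = j}"] finRS by (simp add: card_cartesian_product)
  have "card {x\<in>R \<times> S. f x = j} > 0"
    using good \<open>real (card A * card B) > 0\<close> by (cases "card {x\<in>R \<times> S. f x = j} = 0") auto
  then have posRS: "card R > 0" "card S > 0" using le_size by (auto intro: gr0I)
  define e where "e a = {b\<in>S. f (a, b) \<noteq> j}" for a
  have "(\<Sum>a\<in>R. real (card (e a))) = real (card (Sigma R e))"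
    using finRS by (simp add: e_def card_SigmaI)
  also have "Sigma R e = {x\<in>R \<times> S. f x \<noteq> j}" by (auto simp: e_def)
  also have "real (card {x\<in>R \<times> S. f x \<noteq> j}) \<le> real (card R) * real (card S) / \<mu>"
  proof -
    have "\<mu> * real (card {x\<in>R \<times> S. f x \<noteq> j}) \<le> real (card R * card S)"
      using bad le_size by linarith
    then show ?thesis by (simp add: \<mu>_def pos_le_divide_eq mult.commute)
  qed
  finally have sum_e: "(\<Sum>a\<in>R. real (card (e a))) \<le> (real (card S) / \<mu>) * real (card R)" by (simp add: mult.commute)
  define R' where "R' = {a\<in>R. real (card (e a)) \<le> 2 * (real (card S) / \<mu>)}"
  have R': "real (card R) \<le> 2 * real (card R')"
    unfolding R'_def by (rule card_le_by_Markov) (use finRS posRS sum_e in \<open>auto simp: \<mu>_def\<close>)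
  have R'A: "R' \<subseteq> A" and finR': "finite R'" using RS finRS by (auto simp: R'_def)
  let ?M = "\<lambda>x. real (f x) + (- real j)"
  obtain X c where X: "X \<subseteq> R'" "card X = rank_on R' S ?M"
    and Xc: "\<And>a b. a \<in> R' \<Longrightarrow> b \<in> S \<Longrightarrow> ?M (a, b) = (\<Sum>x\<in>X. c a x * ?M (x, b))"
    by (rule rank_on_basis[OF finR', where B = S and M = ?M]) (rule that)
  have finX: "finite X" using X finR' finite_subset by blast
  have "card X \<le> rank_on R' S (\<lambda>x. real (f x)) + 1"
    unfolding X(2) by (rule rank_on_add_const_le[OF finR'])
  also have "rank_on R' S (\<lambda>x. real (f x)) \<le> rank_on A B (\<lambda>x. real (f x))"
    by (rule rank_on_mono[OF fin(1) R'A RS(2)])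
  finally have cX: "card X \<le> r + 1" using r(1) by simp
  define S' where "S' = S - (\<Union>x\<in>X. e x)"
  have "real (card (\<Union>x\<in>X. e x)) \<le> (\<Sum>x\<in>X. real (card (e x)))"
    using card_UN_le[OF finX, of e] by (metis of_nat_mono of_nat_sum)
  also have "\<dots> \<le> (\<Sum>x\<in>X. 2 * (real (card S) / \<mu>))" using X(1) by (intro sum_mono) (auto simp: R'_def)
  also have "\<dots> \<le> (real r + 1) * (2 * (real (card S) / \<mu>))"
    unfolding sum_constant using cX by (intro mult_right_mono) (auto simp: \<mu>_def)
  also have "\<dots> = real (card S) / 2" by (simp add: \<mu>_def field_simps)
  finally have "2 * real (card (\<Union>x\<in>X. e x)) \<le> real (card S)" by simp
  moreover have "real (card S) \<le> real (card S') + real (card (\<Union>x\<in>X. e x))"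
    using diff_card_le_card_Diff[of "\<Union>x\<in>X. e x" S] finX finRS unfolding S'_def e_def by simp
  ultimately have S': "real (card S) \<le> 2 * real (card S')" by linarith
  show ?thesis
  proof (rule that[of R' S' j])
    show "R' \<subseteq> A" "S' \<subseteq> B" using R'A RS by (auto simp: S'_def)
    show "f (a, b) = j" if "a \<in> R'" "b \<in> S'" for a b
    proof -
      have "?M (x, b) = 0" if "x \<in> X" for x using that \<open>b \<in> S'\<close> by (auto simp: S'_def e_def)
      then have "(\<Sum>x\<in>X. c a x * ?M (x, b)) = 0" by (intro sum.neutral) simp
      then have "?M (a, b) = 0" using Xc[of a b] that by (auto simp: S'_def)
      then show ?thesis by simp
    qed
    have "real (card R) * real (card S) \<le> (2 * real (card R')) * (2 * real (card S'))"
      using R' S' by (intro mult_mono) auto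
    then have four: "real (card {x\<in>R \<times> S. f x = j}) \<le> 4 * real (card R' * card S')"
      using le_size by (simp flip: of_nat_mult)
    note good
    also have "1024 * (real D + 1) * exp (6 * boost D r \<mu>) * real (card {x\<in>R \<times> S. f x = j})
      \<le> 1024 * (real D + 1) * exp (6 * boost D r \<mu>) * (4 * real (card R' * card S'))"
      using four by (intro mult_left_mono) auto
    also have "\<dots> = 4096 * (real D + 1) * exp (6 * boost D r \<mu>) * real (card R' * card S')"
      by simp
    finally show "real (card A * card B) \<le> 4096 * (real D + 1) * exp (6 * boost D r (4 * (real r + 1))) * real (card R' * card S')"
      unfolding \<mu>_def .
  qed
qed

section \<open>Recursion on the rank\<close>

text \<open>A column is determined by its entries in the basis rows, which leaves
  \<open>D + 1\<close> choices for each of them. The map \<open>k\<close> selects one representative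
  among equal columns.\<close>

lemma distinct_columns:
  fixes f :: "'a \<times> 'b \<Rightarrow> nat"
  assumes fin: "finite A" "finite B" and f: "\<And>a b. a \<in> A \<Longrightarrow> b \<in> B \<Longrightarrow> f (a, b) \<le> D"
  obtains B' k where "B' \<subseteq> B" "card B' \<le> (D + 1) ^ rank_on A B (\<lambda>x. real (f x))"
    "\<And>b. b \<in> B \<Longrightarrow> k b \<in> B'" "\<And>a b. a \<in> A \<Longrightarrow> b \<in> B \<Longrightarrow> f (a, k b) = f (a, b)"
proof -
  obtain X c where X: "X \<subseteq> A" "card X = rank_on A B (\<lambda>x. real (f x))"
    and Xc: "\<And>a b. a \<in> A \<Longrightarrow> b \<in> B \<Longrightarrow> real (f (a, b)) = (\<Sum>x\<in>X. c a x * real (f (x, b)))"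
    by (rule rank_on_basis[OF fin(1), where B = B and M = "\<lambda>x. real (f x)"]) (rule that)
  have finX: "finite X" using X fin finite_subset by blast
  define key where "key b = restrict (\<lambda>x. f (x, b)) X" for b
  define k where "k b = inv_into B key (key b)" for b
  have k: "k b \<in> B" "key (k b) = key b" if "b \<in> B" for b
    using that by (auto simp: k_def inv_into_into f_inv_into_f)
  have "key ` B \<subseteq> (\<Pi>\<^sub>E x\<in>X. {..D})" using f X(1) by (auto simp: key_def)
  then have "card (key ` B) \<le> card (\<Pi>\<^sub>E x\<in>X. {..D})"
    by (intro card_mono finite_PiE) (use finX in auto)
  also have "\<dots> = (D + 1) ^ card X" using finX by (simp add: card_PiE)
  finally have "card (key ` B) \<le> (D + 1) ^ card X" .
  moreover have "k ` B = inv_into B key ` key ` B" by (auto simp: k_def)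
  then have "card (k ` B) \<le> card (key ` B)" using fin by (simp add: card_image_le)
  ultimately have "card (k ` B) \<le> (D + 1) ^ rank_on A B (\<lambda>x. real (f x))" using X(2) by simp
  moreover have "f (a, k b) = f (a, b)" if ab: "a \<in> A" "b \<in> B" for a b
  proof -
    have "f (x, k b) = f (x, b)" if "x \<in> X" for x
      using fun_cong[OF k(2)[OF ab(2)], of x] that by (simp add: key_def)
    then have "(\<Sum>x\<in>X. c a x * real (f (x, k b))) = (\<Sum>x\<in>X. c a x * real (f (x, b)))" by simp
    then have "real (f (a, k b)) = real (f (a, b))" using Xc[OF ab] Xc[OF ab(1) k(1)[OF ab(2)]] by linarith
    then show ?thesis by simp
  qed
  ultimately show ?thesis using k(1) by (intro that[of "k ` B" k]) auto
qed

text \<open>The induction statement of the recursion: \<open>f\<close> stays fixed while the sides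
  vary, because the recursion passes to subrectangles.\<close>

definition solvable :: "('a \<times> 'b \<Rightarrow> nat) \<Rightarrow> nat \<Rightarrow> nat \<Rightarrow> real \<Rightarrow> bool"
  where "solvable f D s F \<longleftrightarrow> (\<forall>A B. finite A \<longrightarrow> finite B \<longrightarrow> (\<forall>a\<in>A. \<forall>b\<in>B. f (a, b) \<le> D) \<longrightarrow>
    rank_on A B (\<lambda>x. real (f x)) \<le> s \<longrightarrow> (\<exists>p. computes p A B f \<and> real (leaves p) \<le> F))"

lemma solvableD:
  assumes "solvable f D s F" "finite A" "finite B" "\<And>a b. a \<in> A \<Longrightarrow> b \<in> B \<Longrightarrow> f (a, b) \<le> D"
    "rank_on A B (\<lambda>x. real (f x)) \<le> s"
  shows "\<exists>p. computes p A B f \<and> real (leaves p) \<le> F"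
  using assms unfolding solvable_def by simp

text \<open>Bounds the size of the matrix by its rank, so that the logarithm of the size, which
  governs the number of splitting rounds, becomes \<open>O (s * D)\<close>.\<close>

lemma solvableI_distinct:
  fixes f :: "'a \<times> 'b \<Rightarrow> nat"
  assumes "\<And>A B. finite A \<Longrightarrow> finite B \<Longrightarrow> (\<And>a b. a \<in> A \<Longrightarrow> b \<in> B \<Longrightarrow> f (a, b) \<le> D) \<Longrightarrow>
    rank_on A B (\<lambda>x. real (f x)) \<le> s \<Longrightarrow> card A * card B \<le> (D + 1) ^ (2 * s) \<Longrightarrow>
    \<exists>p. computes p A B f \<and> real (leaves p) \<le> F"
  shows "solvable f D s F"
  unfolding solvable_def
proof (intro allI impI)
  fix A :: "'a set" and B :: "'b set"
  assume fin: "finite A" "finite B" and f0: "\<forall>a\<in>A. \<forall>b\<in>B. f (a, b) \<le> D"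
    and rk: "rank_on A B (\<lambda>x. real (f x)) \<le> s"
  have f: "f (a, b) \<le> D" if "a \<in> A" "b \<in> B" for a b using f0 that by blast
  obtain B' k where B': "B' \<subseteq> B" "card B' \<le> (D + 1) ^ rank_on A B (\<lambda>x. real (f x))"
    "\<And>b. b \<in> B \<Longrightarrow> k b \<in> B'" "\<And>a b. a \<in> A \<Longrightarrow> b \<in> B \<Longrightarrow> f (a, k b) = f (a, b)"
    by (rule distinct_columns[where f = f and D = D, OF fin f]) (assumption | rule that)+
  \<comment> \<open>Rows are reduced as columns of the transpose.\<close>
  let ?g = "\<lambda>x. f (snd x, fst x)"
  have fg: "?g (b, a) \<le> D" if "b \<in> B" "a \<in> A" for a b using f that by simp
  obtain A' h where A': "A' \<subseteq> A" "card A' \<le> (D + 1) ^ rank_on B A (\<lambda>x. real (?g x))"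
    "\<And>a. a \<in> A \<Longrightarrow> h a \<in> A'" "\<And>b a. b \<in> B \<Longrightarrow> a \<in> A \<Longrightarrow> ?g (b, h a) = ?g (b, a)"
    by (rule distinct_columns[where f = ?g and D = D, OF fin(2,1) fg]) (assumption | rule that)+
  have "rank_on B A (\<lambda>x. real (?g x)) \<le> rank_on A B (\<lambda>x. real (f x))"
    using rank_on_transpose_le[OF fin(1), of B "\<lambda>x. real (f x)"] by (simp add: case_prod_unfold)
  then have rg: "rank_on B A (\<lambda>x. real (?g x)) \<le> s" using rk by linarith
  have "card A' \<le> (D + 1) ^ s" "card B' \<le> (D + 1) ^ s"
    using A'(2) B'(2) power_increasing[OF rg, of "D + 1"] power_increasing[OF rk, of "D + 1"] by linarith+
  then have "card A' * card B' \<le> (D + 1) ^ s * (D + 1) ^ s" by (rule mult_mono) auto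
  also have "\<dots> = (D + 1) ^ (2 * s)" by (simp add: mult_2 power_add)
  finally have size: "card A' * card B' \<le> (D + 1) ^ (2 * s)" .
  have "rank_on A' B' (\<lambda>x. real (f x)) \<le> s"
    using rank_on_mono[OF fin(1) A'(1) B'(1), of "\<lambda>x. real (f x)"] rk by linarith
  moreover have "finite A'" "finite B'" using A'(1) B'(1) fin finite_subset by blast+
  moreover have "f (a, b) \<le> D" if "a \<in> A'" "b \<in> B'" for a b using f A'(1) B'(1) that by blast
  ultimately obtain p where p: "computes p A' B' f" "real (leaves p) \<le> F"
    using assms[of A' B'] size by blast
  obtain p' where p': "leaves p' = leaves p" "\<And>a b. run p' a b = run p (h a) (k b)"
    using protocol_reindex[of p h k] by blast
  have "computes p' A B f"
    unfolding computes_def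
  proof (intro ballI)
    fix a b assume ab: "a \<in> A" "b \<in> B"
    have "run p' a b = f (h a, k b)" using p(1) ab A'(3) B'(3) by (simp add: p' computes_def)
    also have "\<dots> = f (h a, b)" using B'(4)[OF _ ab(2)] A'(1,3) ab by blast
    also have "\<dots> = f (a, b)" using A'(4)[OF ab(2,1)] by simp
    finally show "run p' a b = f (a, b)" .
  qed
  then show "\<exists>p. computes p A B f \<and> real (leaves p) \<le> F" using p' p(2) by auto
qed

lemma solvable_trivial:
  fixes f :: "'a \<times> 'b \<Rightarrow> nat"
  shows "solvable f D s (1 + (real D + 1) ^ (2 * s))"
proof (rule solvableI_distinct)
  fix A :: "'a set" and B :: "'b set"
  assume fin: "finite A" "finite B" and size: "card A * card B \<le> (D + 1) ^ (2 * s)"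
  obtain p where p: "computes p A B f" "leaves p \<le> 1 + card A * card B"
    using protocol_enumerate[OF fin, of f] by blast
  have "real (card A * card B) \<le> (real D + 1) ^ (2 * s)"
    using size of_nat_mono[of "card A * card B" "(D + 1) ^ (2 * s)", where 'a = real] by (simp add: add.commute)
  moreover have "real (leaves p) \<le> 1 + real (card A * card B)"
    using of_nat_mono[OF p(2), where 'a = real] by simp
  ultimately show "\<exists>p. computes p A B f \<and> real (leaves p) \<le> 1 + (real D + 1) ^ (2 * s)"
    by (intro exI[of _ p]) (use p(1) in auto)
qed

section \<open>Splitting along monochromatic rectangles\<close>

text \<open>The bound of \<open>monochromatic_rectangle\<close> on the inverse relative size of the
  rectangle.\<close>

definition rect_ratio :: "nat \<Rightarrow> nat \<Rightarrow> real"
  where "rect_ratio D s = 4096 * (real D + 1) * exp (6 * boost D s (4 * (real s + 1)))"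

lemma rect_ratio_ge_1:
  assumes "D \<ge> 1"
  shows "rect_ratio D s \<ge> 1"
proof -
  have "1 * 1 \<le> (8 * real D) * (4 * (real s + 1))" using assms by (intro mult_mono) auto
  then have "boost D s (4 * (real s + 1)) \<ge> 0"
    unfolding boost_def by (intro mult_nonneg_nonneg ln_ge_zero) auto
  then have "1 * 1 \<le> 4096 * (real D + 1) * exp (6 * boost D s (4 * (real s + 1)))"
    by (intro mult_mono) auto
  then show ?thesis by (simp add: rect_ratio_def)
qed

text \<open>
  Given a monochromatic rectangle \<open>R \<times> S\<close> with value \<open>j\<close>, the zero block of \<open>f - j\<close> forces
  \<open>R \<times> B\<close> or \<open>A \<times> S\<close> to have about half the rank. The owner of that side announces whether the
  input lies in it; if not, the matrix has shrunk by the factor \<open>1 - 1 / rect_ratio\<close>.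
\<close>
lemma protocol_by_rectangles:
  fixes f :: "'a \<times> 'b \<Rightarrow> nat"
  assumes sol: "solvable f D ((s + 3) div 2) G" and G: "G \<ge> 1" and D: "D \<ge> 1" and s: "s \<ge> 1"
    and "finite A" "finite B" "\<And>a b. a \<in> A \<Longrightarrow> b \<in> B \<Longrightarrow> f (a, b) \<le> D"
    and "rank_on A B (\<lambda>x. real (f x)) \<le> s"
  shows "\<exists>p. computes p A B f \<and>
    real (leaves p) \<le> (if card A * card B = 0 then 1 else 1 + G * (1 + rect_ratio D s * ln (real (card A * card B))))"
  using assms(5-8)
proof (induction "card A * card B" arbitrary: A B rule: less_induct)
  case less
  note fin = less.prems(1,2) and f = less.prems(3) and rk = less.prems(4)
  define E where "E = rect_ratio D s"
  have E: "E \<ge> 1" unfolding E_def by (rule rect_ratio_ge_1[OF D])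
  show ?case
  proof (cases "card A * card B = 0")
    case True
    then have "A = {} \<or> B = {}" using fin by auto
    then have "computes (Output undefined) A B f" by (auto simp: computes_def)
    then show ?thesis using True by (intro exI[of _ "Output undefined"]) simp
  next
    case False
    then have nz: "card A * card B \<noteq> 0" .
    define n where "n = card A * card B"
    have n: "n > 0" and ne: "A \<noteq> {}" "B \<noteq> {}" using False by (auto simp: n_def)
    obtain R S j where RS: "R \<subseteq> A" "S \<subseteq> B" and j: "\<And>a b. a \<in> R \<Longrightarrow> b \<in> S \<Longrightarrow> f (a, b) = j"
      and big: "real n \<le> E * real (card R * card S)"
      by (rule monochromatic_rectangle[where f = f and D = D, OF fin ne f D rk s,
            folded rect_ratio_def n_def, folded E_def]) (assumption | rule that)+
    have finRS: "finite R" "finite S" using RS fin finite_subset by blast+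
    have posRS: "card R * card S > 0" using big n by (intro gr0I) auto
    have shrink: "real n' \<le> real n * exp (- 1 / E)" if "n' + card R * card S \<le> n" for n'
    proof -
      have "real n / E \<le> real (card R * card S)" using big E by (simp add: pos_divide_le_eq mult.commute)
      moreover have "real n' + real (card R * card S) \<le> real n" using that by linarith
      ultimately have "real n' \<le> real n * (1 + (- 1 / E))" by (simp add: algebra_simps)
      also have "\<dots> \<le> real n * exp (- 1 / E)" by (intro mult_left_mono exp_ge_add_one_self) simp
      finally show ?thesis .
    qed
    \<comment> \<open>One round adds at most \<open>G\<close> leaves and lowers \<open>ln n\<close>
      by at least \<open>1 / E\<close>, so the bound drops by \<open>G\<close> as well. An empty
      remainder is treated apart, its logarithm being meaningless.\<close>
    have cost: "G + x \<le> 1 + G * (1 + E * ln (real n))"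
      if x: "x \<le> (if n' = 0 then 1 else 1 + G * (1 + E * ln (real n')))" and n': "n' + card R * card S \<le> n" for x n'
    proof (cases "n' = 0")
      case True
      have "0 \<le> G * (E * ln (real n))" using G E n by simp
      then show ?thesis using x True by (simp add: algebra_simps)
    next
      case False
      have "ln (real n') \<le> ln (real n * exp (- 1 / E))"
        using shrink[OF n'] False n by (subst ln_le_cancel_iff) auto
      also have "\<dots> = ln (real n) - 1 / E" using n by (simp add: ln_mult)
      finally have "E * ln (real n') \<le> E * (ln (real n) - 1 / E)" using E by (intro mult_left_mono) auto
      also have "\<dots> = E * ln (real n) - 1" using E by (simp add: algebra_simps)
      finally have "G * (1 + E * ln (real n')) \<le> G * (E * ln (real n))"
        using G by (intro mult_left_mono) auto
      then show ?thesis using x False by (simp add: algebra_simps)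
    qed
    let ?M = "\<lambda>x. real (f x) + (- real j)"
    have "rank_on R B ?M + rank_on A S ?M \<le> rank_on A B ?M"
      by (rule rank_on_zero_block[OF fin(1) RS]) (simp add: j)
    moreover have "rank_on A B ?M \<le> s + 1"
      using rank_on_add_const_le[OF fin(1), of B "\<lambda>x. real (f x)" "- real j"] rk by linarith
    \<comment> \<open>The two ranks add up to at most \<open>s + 1\<close>, so one is at most half
      of that. Adding \<open>j\<close> back costs one more, whence
      \<open>(s + 3) div 2\<close>.\<close>
    ultimately have half: "2 * rank_on R B ?M \<le> s + 1 \<or> 2 * rank_on A S ?M \<le> s + 1" by linarith
    have shift_back: "rank_on A' B' (\<lambda>x. real (f x)) \<le> rank_on A' B' ?M + 1" if "finite A'" for A' B'
      using rank_on_add_const_le[OF that, of B' ?M "real j"] by simp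
    have fsub: "f (a, b) \<le> D" if "A' \<subseteq> A" "B' \<subseteq> B" "a \<in> A'" "b \<in> B'" for A' B' a b
      using f[of a b] that by blast
    have sub: "\<exists>p. computes p A' B' f \<and> real (leaves p) \<le> G"
      if "A' \<subseteq> A" "B' \<subseteq> B" "rank_on A' B' (\<lambda>x. real (f x)) \<le> (s + 3) div 2" for A' B'
      by (rule solvableD[OF sol finite_subset[OF that(1) fin(1)] finite_subset[OF that(2) fin(2)] _ that(3)])
        (rule fsub[OF that(1,2)])
    have IH: "\<exists>p. computes p A' B' f \<and> real (leaves p) \<le>
        (if card A' * card B' = 0 then 1 else 1 + G * (1 + E * ln (real (card A' * card B'))))"
      if "A' \<subseteq> A" "B' \<subseteq> B" "card A' * card B' < card A * card B" for A' B'
    proof -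
      have "rank_on A' B' (\<lambda>x. real (f x)) \<le> s"
        using rank_on_mono[OF fin(1) that(1,2), of "\<lambda>x. real (f x)"] rk by linarith
      then show ?thesis
        unfolding E_def
        by (intro less.hyps[OF that(3) finite_subset[OF that(1) fin(1)] finite_subset[OF that(2) fin(2)]])
          (rule fsub[OF that(1,2)])
    qed
    show ?thesis
    proof (cases "2 * rank_on R B ?M \<le> s + 1")
      case True
      then have "rank_on R B (\<lambda>x. real (f x)) \<le> (s + 3) div 2" using shift_back[OF finRS(1), of B] by linarith
      then obtain p1 where p1: "computes p1 R B f" "real (leaves p1) \<le> G"
        using sub[OF RS(1) order_refl] by blast
      have size: "card (A - R) * card B + card R * card S \<le> n"
      proof -
        have "card R * card S \<le> card R * card B" using card_mono[OF fin(2) RS(2)] by simp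
        moreover have "card (A - R) * card B + card R * card B = n"
          using card_Diff_subset[OF finRS(1) RS(1)] card_mono[OF fin(1) RS(1)]
          by (simp add: n_def add_mult_distrib[symmetric])
        ultimately show ?thesis by linarith
      qed
      then have "card (A - R) * card B < card A * card B" using posRS unfolding n_def by linarith
      then obtain p0 where p0: "computes p0 (A - R) B f"
        "real (leaves p0) \<le> (if card (A - R) * card B = 0 then 1
          else 1 + G * (1 + E * ln (real (card (A - R) * card B))))"
        using IH[OF Diff_subset order_refl] by blast
      have "real (leaves (Alice (\<lambda>a. a \<in> R) p0 p1)) \<le> 1 + G * (1 + E * ln (real n))"
        using cost[OF p0(2) size] p1(2) by simp
      moreover have "computes (Alice (\<lambda>a. a \<in> R) p0 p1) A B f"
        using p0(1) p1(1) by (auto simp: computes_def)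
      ultimately show ?thesis unfolding if_not_P[OF nz] n_def E_def by blast
    next
      case False
      then have "2 * rank_on A S ?M \<le> s + 1" using half by blast
      then have "rank_on A S (\<lambda>x. real (f x)) \<le> (s + 3) div 2" using shift_back[OF fin(1), of S] by linarith
      then obtain p1 where p1: "computes p1 A S f" "real (leaves p1) \<le> G"
        using sub[OF order_refl RS(2)] by blast
      have size: "card A * card (B - S) + card R * card S \<le> n"
      proof -
        have "card R * card S \<le> card A * card S" using card_mono[OF fin(1) RS(1)] by simp
        moreover have "card A * card (B - S) + card A * card S = n"
          using card_Diff_subset[OF finRS(2) RS(2)] card_mono[OF fin(2) RS(2)]
          by (simp add: n_def add_mult_distrib2[symmetric])
        ultimately show ?thesis by linarith
      qed
      then have "card A * card (B - S) < card A * card B" using posRS unfolding n_def by linarith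
      then obtain p0 where p0: "computes p0 A (B - S) f"
        "real (leaves p0) \<le> (if card A * card (B - S) = 0 then 1
          else 1 + G * (1 + E * ln (real (card A * card (B - S)))))"
        using IH[OF order_refl Diff_subset] by blast
      have "real (leaves (Bob (\<lambda>b. b \<in> S) p0 p1)) \<le> 1 + G * (1 + E * ln (real n))"
        using cost[OF p0(2) size] p1(2) by simp
      moreover have "computes (Bob (\<lambda>b. b \<in> S) p0 p1) A B f"
        using p0(1) p1(1) by (auto simp: computes_def)
      ultimately show ?thesis unfolding if_not_P[OF nz] n_def E_def by blast
    qed
  qed
qed

lemma solvable_mono: "solvable f D s F \<Longrightarrow> F \<le> F' \<Longrightarrow> solvable f D s F'"
  unfolding solvable_def by (meson order_trans)

text \<open>With at most \<open>(D + 1) ^ (2 * s)\<close> entries, \<open>ln (D + 1) \<le> D\<close>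
  bounds the logarithm of the size by \<open>2 * s * D\<close>.\<close>

lemma solvable_halve_rank:
  fixes f :: "'a \<times> 'b \<Rightarrow> nat"
  assumes sol: "solvable f D ((s + 3) div 2) G" and G: "G \<ge> 1" and D: "D \<ge> 1" and s: "s \<ge> 1"
  shows "solvable f D s (G * rect_ratio D s * (2 + 2 * real s * real D))"
proof (rule solvableI_distinct)
  fix A :: "'a set" and B :: "'b set"
  assume fin: "finite A" "finite B" and f: "\<And>a b. a \<in> A \<Longrightarrow> b \<in> B \<Longrightarrow> f (a, b) \<le> D"
    and rk: "rank_on A B (\<lambda>x. real (f x)) \<le> s" and size: "card A * card B \<le> (D + 1) ^ (2 * s)"
  define n E where "n = card A * card B" and "E = rect_ratio D s"
  obtain p where p: "computes p A B f" "real (leaves p) \<le> (if n = 0 then 1 else 1 + G * (1 + E * ln (real n)))"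
    using protocol_by_rectangles[OF sol G D s fin f rk] unfolding n_def E_def by blast
  have E: "E \<ge> 1" unfolding E_def by (rule rect_ratio_ge_1[OF D])
  have GE: "1 * 1 \<le> G * E" using G E by (intro mult_mono) auto
  have "1 + G * (1 + E * z) \<le> G * E * (2 + 2 * real s * real D)" if "z \<le> 2 * real s * real D" for z
  proof -
    have "G * E * z \<le> G * E * (2 * real s * real D)" using GE that by (intro mult_left_mono) auto
    moreover have "G * 1 \<le> G * E" using G E by (intro mult_left_mono) auto
    ultimately show ?thesis using GE by (simp add: algebra_simps)
  qed
  moreover have "ln (real n) \<le> 2 * real s * real D" if "n > 0"
  proof -
    have "real n \<le> (real D + 1) ^ (2 * s)"
      using size of_nat_mono[of n "(D + 1) ^ (2 * s)", where 'a = real] by (simp add: n_def add.commute)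
    then have "ln (real n) \<le> ln ((real D + 1) ^ (2 * s))" using that by (subst ln_le_cancel_iff) auto
    also have "\<dots> = real (2 * s) * ln (real D + 1)" by (rule ln_realpow)
    also have "\<dots> \<le> real (2 * s) * real D"
      using ln_add_one_self_le_self[of "real D"] by (intro mult_left_mono) (auto simp: add.commute)
    finally show ?thesis by simp
  qed
  ultimately have pos: "1 + G * (1 + E * ln (real n)) \<le> G * E * (2 + 2 * real s * real D)" if "n > 0"
    using that by blast
  have "1 * 1 \<le> G * E * (2 + 2 * real s * real D)" using GE by (intro mult_mono) auto
  then have "real (leaves p) \<le> G * E * (2 + 2 * real s * real D)"
    using p(2) pos by (cases "n = 0") auto
  then show "\<exists>p. computes p A B f \<and> real (leaves p) \<le> G * rect_ratio D s * (2 + 2 * real s * real D)"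
    using p(1) unfolding E_def by blast
qed

section \<open>Solving the recursion\<close>

text \<open>All factors are absorbed into powers of \<open>exp l\<close>, with \<open>l\<close> the
  logarithm in the bound: \<open>4096\<close> takes two, the two polynomial factors one each. The
  remaining exponent is \<open>36\<close> times \<open>D\<^sup>2 * l * sqrt s\<close>, from
  \<open>D + 1 \<le> 2 * D\<close> and \<open>sqrt 2 \<le> 3/2\<close>.\<close>

lemma rect_ratio_le:
  assumes D: "D \<ge> 1" and s: "1 \<le> s" "s \<le> r"
  shows "rect_ratio D s * (2 + 2 * real s * real D)
    \<le> exp (40 * (real D)\<^sup>2 * ln (32 * real D * (real r + 1)) * sqrt (real s))"
proof -
  define l where "l = ln (32 * real D * (real r + 1))"
  have "1 * 2 \<le> real D * (real r + 1)" using D s by (intro mult_mono) auto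
  then have arg: "64 \<le> 32 * real D * (real r + 1)" by simp
  have el: "exp l = 32 * real D * (real r + 1)" unfolding l_def using arg by (intro exp_ln) linarith
  have l0: "l \<ge> 0" unfolding l_def using arg by (intro ln_ge_zero) linarith
  have DD: "real D * 1 \<le> real D * (real r + 1)" by (intro mult_left_mono) auto
  have Ds: "real D * real s \<le> real D * (real r + 1)" using s by (intro mult_left_mono) auto
  have e1: "(4096::real) \<le> exp (2 * l)"
  proof -
    have "(64::real)\<^sup>2 \<le> (exp l)\<^sup>2" using arg unfolding el by (intro power_mono) auto
    then show ?thesis by (simp add: exp_double)
  qed
  have e2: "real D + 1 \<le> exp l" unfolding el mult.assoc using DD D by linarith
  have e3: "2 + 2 * real s * real D \<le> exp l"
    using Ds arg unfolding el mult.assoc mult.commute[of "real s"] by linarith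
  have ls: "ln (8 * real D * (4 * (real s + 1))) \<le> l"
  proof -
    have "real D * (real s + 1) \<le> real D * (real r + 1)" using s by (intro mult_left_mono) auto
    moreover have "0 < real D * (real s + 1)" using D by simp
    ultimately show ?thesis unfolding l_def using D by (subst ln_le_cancel_iff) (auto simp: mult.left_commute)
  qed
  have "1 * 1 \<le> (8 * real D) * (4 * (real s + 1))" using D by (intro mult_mono) auto
  then have ls1: "1 \<le> 8 * real D * (4 * (real s + 1))" by simp
  have sq: "sqrt (2 * real s) \<le> 3/2 * sqrt (real s)"
  proof -
    have "sqrt (2::real) \<le> 3/2" by (rule real_le_lsqrt) (auto simp: power2_eq_square)
    then show ?thesis unfolding real_sqrt_mult by (intro mult_right_mono) auto
  qed
  have "boost D s (4 * (real s + 1)) \<le> 2 * (2 * real D) * l * real D * (3/2 * sqrt (real s))"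
    unfolding boost_def using ls ls1 sq l0 D by (intro mult_mono mult_nonneg_nonneg) auto
  then have b: "6 * boost D s (4 * (real s + 1)) \<le> 36 * (real D)\<^sup>2 * l * sqrt (real s)"
    by (simp add: power2_eq_square mult_ac)
  have "rect_ratio D s * (2 + 2 * real s * real D)
      \<le> exp (2 * l) * exp l * exp (36 * (real D)\<^sup>2 * l * sqrt (real s)) * exp l"
    unfolding rect_ratio_def using e1 e2 e3 b by (intro mult_mono) auto
  also have "\<dots> = exp (4 * l * (1 * 1) + 36 * (real D)\<^sup>2 * l * sqrt (real s))"
    by (simp add: exp_add[symmetric] algebra_simps)
  also have "\<dots> \<le> exp (4 * l * ((real D)\<^sup>2 * sqrt (real s)) + 36 * (real D)\<^sup>2 * l * sqrt (real s))"
    using l0 D s by (intro iffD2[OF exp_le_cancel_iff] add_right_mono mult_left_mono mult_mono) auto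
  also have "\<dots> = exp (40 * (real D)\<^sup>2 * l * sqrt (real s))" by (simp add: algebra_simps)
  finally show ?thesis by (simp add: l_def)
qed

text \<open>For \<open>s > 11\<close> the new rank is at most \<open>16/25\<close> of the old one,
  so its square root shrinks by \<open>4/5\<close>, and \<open>222 * 4/5 + 40 \<le> 222\<close>
  closes the induction. Smaller ranks are enumerated. The logarithm refers to the initial
  \<open>r\<close> and thus stays the same at all levels.\<close>

lemma solvable_bound:
  fixes f :: "'a \<times> 'b \<Rightarrow> nat"
  assumes D: "D \<ge> 1" and "1 \<le> s" "s \<le> r"
  shows "solvable f D s (exp (222 * (real D)\<^sup>2 * ln (32 * real D * (real r + 1)) * sqrt (real s)))"
  using assms(2,3)
proof (induction s rule: less_induct)
  case (less s)
  define l where "l = ln (32 * real D * (real r + 1))"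
  have "1 * 2 \<le> real D * (real r + 1)" using D less.prems by (intro mult_mono) auto
  then have arg: "64 \<le> 32 * real D * (real r + 1)" by simp
  have el: "exp l = 32 * real D * (real r + 1)" unfolding l_def using arg by (intro exp_ln) linarith
  have l0: "l \<ge> 0" unfolding l_def using arg by (intro ln_ge_zero) linarith
  show ?case
  proof (cases "s \<le> 11")
    case True
    have DD: "real D * 1 \<le> real D * (real r + 1)" by (intro mult_left_mono) auto
    have D1: "real D + 1 \<le> exp l" unfolding el mult.assoc using DD D by linarith
    have "(real D + 1) ^ (2 * s) \<le> (real D + 1) ^ 22" using True by (intro power_increasing) auto
    also have "\<dots> \<le> exp l ^ 22" using D1 by (intro power_mono) auto
    finally have "1 + (real D + 1) ^ (2 * s) \<le> 1 + exp l ^ 22" by simp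
    also have "\<dots> \<le> exp l ^ 22 + exp l ^ 22" using l0 by simp
    also have "\<dots> \<le> exp l * exp l ^ 22" using arg unfolding el[symmetric] by simp
    also have "\<dots> = exp (23 * l * (1 * 1))" by (simp add: exp_add[symmetric] exp_of_nat_mult[symmetric])
    also have "\<dots> \<le> exp (222 * l * ((real D)\<^sup>2 * sqrt (real s)))"
      using l0 D less.prems by (intro iffD2[OF exp_le_cancel_iff] mult_mono) auto
    also have "\<dots> = exp (222 * (real D)\<^sup>2 * l * sqrt (real s))" by (simp add: mult_ac)
    finally have "1 + (real D + 1) ^ (2 * s) \<le> exp (222 * (real D)\<^sup>2 * l * sqrt (real s))" .
    then show ?thesis unfolding l_def by (rule solvable_mono[OF solvable_trivial])
  next
    case False
    define s' where "s' = (s + 3) div 2"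
    define G where "G = exp (222 * (real D)\<^sup>2 * l * sqrt (real s'))"
    have s': "s' < s" "1 \<le> s'" "25 * s' \<le> 16 * s" using False by (auto simp: s'_def)
    then have "solvable f D s' G"
      using less.IH[of s'] less.prems by (simp add: G_def l_def)
    moreover have "G \<ge> 1" unfolding G_def using l0 by simp
    ultimately have sol: "solvable f D s (G * rect_ratio D s * (2 + 2 * real s * real D))"
      unfolding s'_def using D less.prems by (intro solvable_halve_rank)
    have sq: "sqrt (real s') \<le> 4/5 * sqrt (real s)"
    proof -
      have "real s' \<le> (4/5)\<^sup>2 * real s" using s'(3) by (simp add: power2_eq_square)
      then have "sqrt (real s') \<le> sqrt ((4/5)\<^sup>2 * real s)" by (rule real_sqrt_le_mono)
      then show ?thesis by (simp add: real_sqrt_mult)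
    qed
    have "G * rect_ratio D s * (2 + 2 * real s * real D) \<le> G * exp (40 * (real D)\<^sup>2 * l * sqrt (real s))"
      unfolding mult.assoc[of G] l_def
      using rect_ratio_le[OF D less.prems] by (intro mult_left_mono) (auto simp: G_def)
    also have "\<dots> = exp ((real D)\<^sup>2 * l * (222 * sqrt (real s') + 40 * sqrt (real s)))"
      by (simp add: G_def exp_add[symmetric] algebra_simps)
    also have "\<dots> \<le> exp ((real D)\<^sup>2 * l * (222 * sqrt (real s)))"
    proof -
      have "222 * sqrt (real s') + 40 * sqrt (real s) \<le> 222 * sqrt (real s)"
        using sq real_sqrt_ge_zero[of "real s"] by linarith
      then show ?thesis using l0 by (intro iffD2[OF exp_le_cancel_iff] mult_left_mono) auto
    qed
    also have "\<dots> = exp (222 * (real D)\<^sup>2 * l * sqrt (real s))" by (simp add: mult_ac)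
    finally show ?thesis using solvable_mono[OF sol] by (simp add: l_def)
  qed
qed

text \<open>The fourth power from balancing gives the factor \<open>888 = 4 * 222\<close>, and the
  logarithm is at most \<open>8 * D * log 2 m\<close>. The resulting \<open>7104 * D ^ 3\<close> is
  at most \<open>b ^ 16\<close>, which explains the constant \<open>16\<close>.\<close>

lemma depth_bound:
  fixes D r d :: nat
  assumes D: "D \<ge> 1" and r: "r \<ge> 1"
    and d: "real (2 ^ d) \<le> exp (222 * (real D)\<^sup>2 * ln (32 * real D * (real r + 1)) * sqrt (real r)) ^ 4"
  shows "real d \<le> real (max 2 D) powr (16 * real D) * sqrt (real r) * log 2 (real (max 2 r))"
proof -
  define l where "l = ln (32 * real D * (real r + 1))"
  define m where "m = real (max 2 r)"
  define b where "b = real (max 2 D)"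
  have m: "m \<ge> 2" "real r \<le> m" and b: "b \<ge> 2" "real D \<le> b" by (auto simp: m_def b_def)
  have D1: "real D \<ge> 1" using D by simp
  have lm: "log 2 m \<ge> 1" using m by (simp add: le_log_iff)
  have "real (2 ^ d) \<le> exp (4 * (222 * (real D)\<^sup>2 * l * sqrt (real r)))"
    using d unfolding l_def by (simp add: exp_of_nat_mult[symmetric])
  then have "ln (real (2 ^ d)) \<le> ln (exp (4 * (222 * (real D)\<^sup>2 * l * sqrt (real r))))"
    by (subst ln_le_cancel_iff) auto
  then have "real d * ln 2 \<le> 888 * (real D)\<^sup>2 * l * sqrt (real r)"
    by (simp add: ln_realpow mult.assoc)
  then have "real d \<le> 888 * (real D)\<^sup>2 * l * sqrt (real r) / ln 2"
    by (simp add: pos_le_divide_eq)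
  also have "\<dots> = 888 * (real D)\<^sup>2 * sqrt (real r) * log 2 (32 * real D * (real r + 1))"
    by (simp add: log_def l_def)
  also have "\<dots> \<le> 888 * (real D)\<^sup>2 * sqrt (real r) * (8 * real D * log 2 m)"
  proof (rule mult_left_mono)
    have "32 * real D * (real r + 1) \<le> 32 * real D * (2 * m)" using m by (intro mult_left_mono) auto
    then have "log 2 (32 * real D * (real r + 1)) \<le> log 2 (2 ^ 6 * real D * m)"
      using D1 by (subst log_le_cancel_iff) auto
    also have "\<dots> = 6 + log 2 (real D) + log 2 m"
      using D1 m by (simp only: log_mult log_nat_power) (simp add: log_mult log_nat_power del: power_numeral)
    also have "log 2 (real D) \<le> real D"
    proof -
      have "real D \<le> 2 powr real D" by (simp add: powr_realpow less_imp_le)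
      then show ?thesis using D1 by (simp add: log_le_iff)
    qed
    also have "6 + real D + log 2 m \<le> (7 + real D) * log 2 m"
    proof -
      have "(6 + real D) * 1 \<le> (6 + real D) * log 2 m" using lm by (intro mult_left_mono) auto
      then show ?thesis by (simp add: algebra_simps)
    qed
    also have "\<dots> \<le> 8 * real D * log 2 m" using lm D1 by (intro mult_right_mono) auto
    finally show "log 2 (32 * real D * (real r + 1)) \<le> 8 * real D * log 2 m" by simp
  qed auto
  also have "\<dots> = 7104 * (real D) ^ 3 * (sqrt (real r) * log 2 m)"
    by (simp add: power2_eq_square power3_eq_cube)
  also have "\<dots> \<le> b powr (16 * real D) * (sqrt (real r) * log 2 m)"
  proof (rule mult_right_mono)
    have "(7104::real) \<le> 2 ^ 13" by simp
    also have "\<dots> \<le> b ^ 13" using b by (intro power_mono) auto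
    finally have "7104 * (real D) ^ 3 \<le> b ^ 13 * b ^ 3"
      using b by (intro mult_mono power_mono) auto
    also have "\<dots> = b ^ 16" unfolding power_add[symmetric] by simp
    also have "\<dots> = b powr 16" using b by simp
    also have "\<dots> \<le> b powr (16 * real D)" using b D1 by (intro powr_mono) auto
    finally show "7104 * (real D) ^ 3 \<le> b powr (16 * real D)" .
    show "0 \<le> sqrt (real r) * log 2 m" using lm by simp
  qed
  finally show ?thesis by (simp add: m_def b_def mult.assoc)
qed

text \<open>The two \<open>max 2\<close> guard the degenerate cases: for \<open>\<Delta> = 1\<close>
  the power would absorb no constant factor, and for \<open>r = 1\<close> the logarithm would vanish
  although communication may be necessary.\<close>

theorem theorem1:
  shows "\<exists>C::real. C > 0 \<and>
    (\<forall>(A :: 'a set) (B :: 'b set) (\<Delta> :: nat) (r :: nat) (f :: 'a \<times> 'b \<Rightarrow> nat).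
      finite A \<longrightarrow> finite B \<longrightarrow> \<Delta> > 0 \<longrightarrow> f \<in> A \<times> B \<rightarrow> {0..\<Delta>} \<longrightarrow>
      rank_on A B (\<lambda>x. real (f x)) = r \<longrightarrow>
      (\<exists>p :: ('a, 'b, nat) protocol. computes p A B f \<and>
        real (protocol_length p A B)
          \<le> real (max 2 \<Delta>) powr (C * real \<Delta>) * sqrt (real r) * log 2 (real (max 2 r))))"
proof (intro exI[of _ 16] conjI allI impI)
  fix A :: "'a set" and B :: "'b set" and \<Delta> r :: nat and f :: "'a \<times> 'b \<Rightarrow> nat"
  assume fin: "finite A" "finite B" and \<Delta>: "\<Delta> > 0" and f: "f \<in> A \<times> B \<rightarrow> {0..\<Delta>}"
    and r: "rank_on A B (\<lambda>x. real (f x)) = r"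
  let ?bound = "real (max 2 \<Delta>) powr (16 * real \<Delta>) * sqrt (real r) * log 2 (real (max 2 r))"
  show "\<exists>p :: ('a, 'b, nat) protocol. computes p A B f \<and> real (protocol_length p A B) \<le> ?bound"
  \<comment> \<open>For rank zero the bound is zero, and \<open>f\<close> vanishes on all inputs, so
    a single leaf suffices.\<close>
  proof (cases "r = 0")
    case True
    obtain X c where X: "X \<subseteq> A" "card X = rank_on A B (\<lambda>x. real (f x))"
      and Xc: "\<And>a b. a \<in> A \<Longrightarrow> b \<in> B \<Longrightarrow> real (f (a, b)) = (\<Sum>x\<in>X. c a x * real (f (x, b)))"
      by (rule rank_on_basis[OF fin(1), where B = B and M = "\<lambda>x. real (f x)"]) (rule that)
    have "X = {}" using X r True fin(1) by (metis card_0_eq finite_subset)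
    then have "computes (Output 0) A B f" using Xc by (simp add: computes_def)
    moreover have "protocol_length (Output 0 :: ('a, 'b, nat) protocol) A B \<le> 0"
      by (rule protocol_length_le) simp
    ultimately show ?thesis using True by (intro exI[of _ "Output 0"]) simp
  next
    case False
    have f': "\<forall>a\<in>A. \<forall>b\<in>B. f (a, b) \<le> \<Delta>" using f by auto
    have "solvable f \<Delta> r (exp (222 * (real \<Delta>)\<^sup>2 * ln (32 * real \<Delta> * (real r + 1)) * sqrt (real r)))"
      by (rule solvable_bound) (use \<Delta> False in auto)
    then obtain p where p: "computes p A B f"
      "real (leaves p) \<le> exp (222 * (real \<Delta>)\<^sup>2 * ln (32 * real \<Delta> * (real r + 1)) * sqrt (real r))"
      unfolding solvable_def using fin f' r by blast
    \<comment> \<open>Balancing converts the bound on the number of leaves into a bound on the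
      depth.\<close>
    obtain p' d where p': "\<And>a b. run p' a b = run p a b" "\<And>a b. bits_exchanged p' a b \<le> d"
      "2 ^ d \<le> leaves p ^ 4"
      using protocol_balance[of p] by blast
    have "real (2 ^ d) \<le> real (leaves p) ^ 4" using of_nat_mono[OF p'(3), where 'a = real] by simp
    also have "\<dots> \<le> exp (222 * (real \<Delta>)\<^sup>2 * ln (32 * real \<Delta> * (real r + 1)) * sqrt (real r)) ^ 4"
      using p(2) by (rule power_mono) simp
    finally have "real d \<le> ?bound" by (rule depth_bound[rotated 2]) (use \<Delta> False in auto)
    moreover have "protocol_length p' A B \<le> d" using p'(2) by (intro protocol_length_le)
    ultimately have "real (protocol_length p' A B) \<le> ?bound" by linarith
    moreover have "computes p' A B f" using p(1) p'(1) by (simp add: computes_def)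
    ultimately show ?thesis by blast
  qed
qed simp

end
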